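(* Let $k\ge1$, $m\ge 1$, and let $(u_i^n)_{i\ge0}$, $1\le n\le k$, be $k$ sequences of complex numbers. Put ${\bf z}^i=(z^i_0,\dots,z^i_{k-1})^T$ with $z^i_p=u_i^{p+1}$, and suppose that for all $i\ge1$ and $0\le p\le k-1$ $$z^i_p={}^{0}_{p}C+\sum_{j=1}^{m}\sum_{l_1,\dots,l_j=0}^{k-1}{}^{j}_{p}C_{l_1,\dots,l_j}\prod_{s=1}^{j}z^{i-1}_{l_s},$$ where the complex coefficients satisfy ${}^{j}_{p}C_{l_1,\dots,l_j}=0$ unless $l_1\le\dots\le l_j$. Let $B\in\mathbb{C}^k$ (components $B_0,\dots,B_{k-1}$) satisfy, for all $0\le p\le k-1$, $$B_p=\sum_{s=0}^{m}\frac1{s!}\sum_{l_1,\dots,l_s=0}^{k-1}\sum_{\sigma}{}^{s}_{p}C_{l_{\sigma_1},\dots,l_{\sigma_s}}\prod_{t=1}^{s}B_{l_t},$$ where $\sigma$ runs over all permutations of $\{1,\dots,s\}$. Let $A$ be an invertible complex $k\times k$ matrix (indices from $0$) such that the $k\times k$ array $${}^{1}_{p}C''_{x}=\sum_{j,l=0}^{k-1}A^{-1}_{pj}\,{}^{1}_{j}C'_{l}\,A_{lx},\qquad {}^{1}_{p}C'_{l_1}=\sum_{s=1}^{m}\sum_{l_2,\dots,l_s=0}^{k-1}\frac{1}{(s-1)!}\sum_{\sigma}{}^{s}_{p}C_{l_{\sigma_1},\dots,l_{\sigma_s}}\prod_{t=2}^{s}B_{l_t},$$ is upper triangular (i.e.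 ${}^{1}_{p}C''_{x}=0$ for $p>x$). Let $\lambda'_0,\dots,\lambda'_{k-1}$ be the eigenvalues of the matrix $({}^{1}_{p}C''_{x})_{p,x}$, all nonzero and with $|\lambda'_0|\ne1$, and suppose that the system $$\begin{cases}x_0+x_1\log_{|\lambda'_0|}|\lambda'_1|+\dots+x_{k-1}\log_{|\lambda'_0|}|\lambda'_{k-1}|=0\\ \operatorname{Arg}(\lambda'_0)x_0+\operatorname{Arg}(\lambda'_1)x_1+\dots+\operatorname{Arg}(\lambda'_{k-1})x_{k-1}=2\pi t\end{cases}$$ has no non-trivial solution $x_0,\dots,x_{k-1},t\in\mathbb{Z}$. Then for every $1\le n\le k$ and every $i\ge 0$, $$u_i^n=B_{n-1}+\sum_{s=1}^{k}\sum_{l=1}^{\infty}\sum_{j=1}^{l}A_{n-1,s-1}\,\tilde v'^{\,s}_{j}\,(\tilde T'_{jj})^{i}\,\tilde P'^{-1}_{jl}\,\tilde y'^{0}_{l},$$ where $\tilde T'$ and $\tilde{\bf y}'^{0}$ are the non-redundant transition matrix and the non-redundant initial auxiliary vector of the transformed recurrence (defined in the context), and where, for $a,b\ge0$: $\tilde v'^{\,b}_a=0$ for $b>a$, $\tilde v'^{\,a}_a=1$, and for $b<a$ $$\tilde v'^{\,b}_a=\sum_{p=0}^{a-b-1}\ \sum_{b=l_0<l_1<\dots<l_p<l_{p+1}=a}(-1)^{p+1}\prod_{j=0}^{p}\frac{\tilde T'_{l_j,l_{j+1}}}{\tilde T'_{l_j,l_j}-\tilde T'_{aa}};$$ $\tilde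 P'^{-1}_{ba}=0$ for $b>a$, $\tilde P'^{-1}_{aa}=1$, and for $b<a$ $$\tilde P'^{-1}_{ba}=\sum_{p=0}^{a-b-1}\ \sum_{b=l_0<l_1<\dots<l_p<l_{p+1}=a}(-1)^{p+1}\prod_{j=0}^{p}\frac{\tilde v'^{\,l_j}_{l_{j+1}}}{\tilde v'^{\,l_j}_{l_j}}.$$
   Context: Transformed recurrence: set ${\bf z}'^{i}=A^{-1}({\bf z}^{i}-B)$, with components $z'^i_0,\dots,z'^i_{k-1}$ and $u'^{\,n}_i=z'^i_{n-1}$. These satisfy a polynomial depth-one recurrence $z'^i_p=G_p(z'^{i-1}_0,\dots,z'^{i-1}_{k-1})$, where $G=(G_0,\dots,G_{k-1})$ is the polynomial map $G({\bf w})=A^{-1}(F(A{\bf w}+B)-B)$ and $F$ is the polynomial map defining the original recurrence ${\bf z}^i=F({\bf z}^{i-1})$. Non-redundant auxiliary vector: list all monomials in $k$ variables $w_0,\dots,w_{k-1}$, each exactly once, written as $w_{l_1}\cdots w_{l_s}$ with $l_1\le\dots\le l_s$, ordered first by degree $s$ and within each degree lexicographically in $(l_1,\dots,l_s)$; index the list from $0$. Thus monomial $0$ is $1$, and monomials $1,\dots,k$ are $w_0,\dots,w_{k-1}$; for $k=2$ the list is $1,w_0,w_1,w_0^2,w_0w_1,w_1^2,\dots$. The vector $\tilde{\bf y}'^{i}$ is the infinite vector whose $l$-th entry $\tilde y'^{i}_l$ is monomial $l$ evaluated at ${\bf w}={\bf z}'^{i}$. Non-redundant transition matrix: $\tilde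 T'_{ab}$ ($a,b\ge0$) is the coefficient of monomial $b$ in the polynomial obtained from monomial $a$ by substituting $w_p\mapsto G_p({\bf w})$, so $\tilde{\bf y}'^{i}=\tilde T'\tilde{\bf y}'^{i-1}$. Conventions: matrices and vectors are indexed from $0$. Superscripts on $\tilde v'$ are component indices, not powers. For $s=0$ the term in the equation for $B_p$ is ${}^{0}_{p}C$. In the inner sums $l_0=b$ and $l_{p+1}=a$ are fixed and $l_1,\dots,l_p$ are summed over integers with the indicated inequalities. "Non-trivial" means that the integers are not all zero. *)

theory Defs
  imports
    "Jordan_Normal_Form.Char_Poly"
    "HOL-Combinatorics.Permutations"
    "HOL-Library.Poly_Mapping"
begin

text \<open>
  The coefficient of the monomial \<open>z_{l_1} \<dots> z_{l_j}\<close> in component \<open>p\<close> of the recurrence is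
  \<open>C p [l_1, \<dots>, l_j]\<close>; the degree \<open>j\<close> is the length of the list.
\<close>

definition index_lists :: "nat \<Rightarrow> nat \<Rightarrow> nat list set" where
  "index_lists k j = {ls. length ls = j \<and> set ls \<subseteq> {..<k}}"

definition state :: "nat \<Rightarrow> (nat \<Rightarrow> nat \<Rightarrow> complex) \<Rightarrow> nat \<Rightarrow> complex vec" where
  "state k u i = vec k (\<lambda>p. u (p + 1) i)"

text \<open>The linear part of the recurrence at the point \<open>B\<close>; the list \<open>ls\<close> is \<open>[l_2, \<dots>, l_s]\<close>.\<close>

definition linear_part ::
  "nat \<Rightarrow> nat \<Rightarrow> (nat \<Rightarrow> nat list \<Rightarrow> complex) \<Rightarrow> complex vec \<Rightarrow> complex mat" where
  "linear_part k m C B = mat k k (\<lambda>(p, l).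
     \<Sum>s = 1..m. \<Sum>ls\<in>index_lists k (s - 1).
       1 / fact (s - 1) *
       (\<Sum>\<sigma> | \<sigma> permutes {..<s}. C p (permute_list \<sigma> (l # ls)) * (\<Prod>t<s - 1. B $ (ls ! t))))"

text \<open>
  A monomial \<open>w_{l_1} \<dots> w_{l_s}\<close> with \<open>l_1 \<le> \<dots> \<le> l_s\<close> is represented by the list
  \<open>[l_1, \<dots>, l_s]\<close>, so that \<^term>\<open>lenlex less_than\<close> is the order by degree, then lexicographic.
\<close>

definition monomials :: "nat \<Rightarrow> nat list set" where
  "monomials k = {ls. sorted ls \<and> set ls \<subseteq> {..<k}}"

definition monomial_rank :: "nat \<Rightarrow> nat list \<Rightarrow> nat" where
  "monomial_rank k ls = card {ms \<in> monomials k. (ms, ls) \<in> lenlex less_than}"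

definition monomial_at :: "nat \<Rightarrow> nat \<Rightarrow> nat list" where
  "monomial_at k a = (THE ls. ls \<in> monomials k \<and> monomial_rank k ls = a)"

lemma finite_monomial_predecessors: "finite {ms \<in> monomials k. (ms, ls) \<in> lenlex less_than}"
proof (rule finite_subset)
  show "{ms \<in> monomials k. (ms, ls) \<in> lenlex less_than}
          \<subseteq> {ms. set ms \<subseteq> {..<k} \<and> length ms \<le> length ls}"
    by (auto simp: monomials_def lenlex_conv)
  show "finite {ms. set ms \<subseteq> {..<k} \<and> length ms \<le> length ls}"
    by (rule finite_lists_length_le) simp
qed

lemma monomial_rank_less:
  assumes "ms \<in> monomials k" "(ms, ls) \<in> lenlex less_than"
  shows "monomial_rank k ms < monomial_rank k ls"
proof -
  have tr: "trans (lenlex less_than)"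
    by (intro lenlex_transI trans_less_than)
  have irr: "(ms, ms) \<notin> lenlex less_than"
    by (rule lenlex_irreflexive) simp
  have "{xs \<in> monomials k. (xs, ms) \<in> lenlex less_than}
          \<subset> {xs \<in> monomials k. (xs, ls) \<in> lenlex less_than}"
    using assms irr by (auto dest: transD[OF tr])
  then show ?thesis
    unfolding monomial_rank_def
    by (rule psubset_card_mono[OF finite_monomial_predecessors])
qed

lemma inj_on_monomial_rank: "inj_on (monomial_rank k) (monomials k)"
proof (rule inj_onI)
  fix ms ls
  assume *: "ms \<in> monomials k" "ls \<in> monomials k" "monomial_rank k ms = monomial_rank k ls"
  have "total (lenlex (less_than :: (nat \<times> nat) set))"
    by (rule total_lenlex) (simp add: total_on_def, linarith)
  then have "ms = ls \<or> (ms, ls) \<in> lenlex less_than \<or> (ls, ms) \<in> lenlex less_than"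
    by (auto simp: total_on_def)
  then show "ms = ls"
    using * monomial_rank_less[of ms k ls] monomial_rank_less[of ls k ms] by auto
qed

lemma bij_betw_monomial_rank:
  assumes "k \<ge> 1"
  shows "bij_betw (monomial_rank k) (monomials k) UNIV"
proof -
  have "a \<in> monomial_rank k ` monomials k" for a
  proof -
    have "range (\<lambda>n. replicate n 0) \<subseteq> monomials k"
      using assms by (auto simp: monomials_def)
    moreover have "inj (\<lambda>n. replicate n (0::nat))"
      by (auto intro!: injI dest: arg_cong[where f = length])
    ultimately have "infinite (monomials k)"
      using finite_subset range_inj_infinite by blast
    then have "infinite (monomial_rank k ` monomials k)"
      using finite_imageD inj_on_monomial_rank by blast
    then obtain ls where ls: "ls \<in> monomials k" "a < monomial_rank k ls"
      by (auto simp: infinite_nat_iff_unbounded)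
    define D where "D = {ms \<in> monomials k. (ms, ls) \<in> lenlex less_than}"
    have "monomial_rank k ` D \<subseteq> {..<monomial_rank k ls}"
      by (auto simp: D_def intro: monomial_rank_less)
    moreover have "card (monomial_rank k ` D) = card {..<monomial_rank k ls}"
      using inj_on_subset[OF inj_on_monomial_rank, of D k]
      by (subst card_image) (auto simp: D_def monomial_rank_def)
    ultimately have "monomial_rank k ` D = {..<monomial_rank k ls}"
      by (intro card_subset_eq) auto
    with ls(2) show ?thesis
      by (auto simp: D_def)
  qed
  then show ?thesis
    using inj_on_monomial_rank by (auto simp: bij_betw_def)
qed

lemma monomial_at:
  assumes "k \<ge> 1"
  shows "monomial_at k a \<in> monomials k" "monomial_rank k (monomial_at k a) = a"
proof -
  have "\<exists>!ls. ls \<in> monomials k \<and> monomial_rank k ls = a"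
    using bij_betw_monomial_rank[OF assms] unfolding bij_betw_def inj_on_def
    by (metis UNIV_I imageE)
  from theI'[OF this] show "monomial_at k a \<in> monomials k" "monomial_rank k (monomial_at k a) = a"
    by (simp_all add: monomial_at_def)
qed

text \<open>
  Polynomials in the variables \<open>w_0, w_1, \<dots>\<close>: finitely supported maps from exponent vectors to
  coefficients.
\<close>

type_synonym cpoly = "(nat \<Rightarrow>\<^sub>0 nat) \<Rightarrow>\<^sub>0 complex"

definition const_poly :: "complex \<Rightarrow> cpoly" where
  "const_poly c = Poly_Mapping.single 0 c"

definition var_poly :: "nat \<Rightarrow> cpoly" where
  "var_poly p = Poly_Mapping.single (Poly_Mapping.single p 1) 1"

definition exponents :: "nat list \<Rightarrow> (nat \<Rightarrow>\<^sub>0 nat)" where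
  "exponents ls = (\<Sum>l\<leftarrow>ls. Poly_Mapping.single l 1)"

text \<open>The polynomial map \<open>F\<close> of the original recurrence, with polynomials \<open>x q\<close> substituted for the
  variables.\<close>

definition F_poly ::
  "nat \<Rightarrow> nat \<Rightarrow> (nat \<Rightarrow> nat list \<Rightarrow> complex) \<Rightarrow> (nat \<Rightarrow> cpoly) \<Rightarrow> nat \<Rightarrow> cpoly" where
  "F_poly k m C x p = const_poly (C p []) +
     (\<Sum>j = 1..m. \<Sum>ls\<in>index_lists k j. const_poly (C p ls) * (\<Prod>s<j. x (ls ! s)))"

text \<open>\<open>G(w) = A\<^sup>-\<^sup>1 (F(A w + B) - B)\<close>, where \<open>A'\<close> is the inverse of \<open>A\<close>.\<close>

definition affine_poly :: "nat \<Rightarrow> complex mat \<Rightarrow> complex vec \<Rightarrow> nat \<Rightarrow> cpoly" where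
  "affine_poly k A B q = (\<Sum>x<k. const_poly (A $$ (q, x)) * var_poly x) + const_poly (B $ q)"

definition G_poly ::
  "nat \<Rightarrow> nat \<Rightarrow> (nat \<Rightarrow> nat list \<Rightarrow> complex) \<Rightarrow> complex mat \<Rightarrow> complex mat \<Rightarrow> complex vec
    \<Rightarrow> nat \<Rightarrow> cpoly" where
  "G_poly k m C A A' B p =
     (\<Sum>q<k. const_poly (A' $$ (p, q)) * (F_poly k m C (affine_poly k A B) q - const_poly (B $ q)))"

definition transition ::
  "nat \<Rightarrow> nat \<Rightarrow> (nat \<Rightarrow> nat list \<Rightarrow> complex) \<Rightarrow> complex mat \<Rightarrow> complex mat \<Rightarrow> complex vec
    \<Rightarrow> nat \<Rightarrow> nat \<Rightarrow> complex" where
  "transition k m C A A' B a b =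
     Poly_Mapping.lookup (\<Prod>l\<leftarrow>monomial_at k a. G_poly k m C A A' B l) (exponents (monomial_at k b))"

definition auxiliary :: "nat \<Rightarrow> complex vec \<Rightarrow> nat \<Rightarrow> complex" where
  "auxiliary k w l = (\<Prod>p\<leftarrow>monomial_at k l. w $ p)"

text \<open>The sequences \<open>b = l_0 < l_1 < \<dots> < l_p < l_{p+1} = a\<close>, including both end points.\<close>

definition chains :: "nat \<Rightarrow> nat \<Rightarrow> nat \<Rightarrow> nat list set" where
  "chains p b a = {ls. length ls = p + 2 \<and> sorted_wrt (<) ls \<and> ls ! 0 = b \<and> ls ! (p + 1) = a}"

text \<open>\<open>evec T b a\<close> is component \<open>b\<close> of the \<open>a\<close>-th eigenvector of the infinite matrix \<open>T\<close>, and
  \<open>evec_inv T b a\<close> the entry in row \<open>b\<close> and column \<open>a\<close> of the inverse of the matrix with the entries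
  \<open>evec T b a\<close>.\<close>

definition evec :: "(nat \<Rightarrow> nat \<Rightarrow> complex) \<Rightarrow> nat \<Rightarrow> nat \<Rightarrow> complex" where
  "evec T b a =
     (if b > a then 0 else if b = a then 1
      else \<Sum>p = 0..a - b - 1. \<Sum>l\<in>chains p b a.
        (- 1) ^ (p + 1) * (\<Prod>j = 0..p. T (l ! j) (l ! (j + 1)) / (T (l ! j) (l ! j) - T a a)))"

definition evec_inv :: "(nat \<Rightarrow> nat \<Rightarrow> complex) \<Rightarrow> nat \<Rightarrow> nat \<Rightarrow> complex" where
  "evec_inv T b a =
     (if b > a then 0 else if b = a then 1
      else \<Sum>p = 0..a - b - 1. \<Sum>l\<in>chains p b a.
        (- 1) ^ (p + 1) * (\<Prod>j = 0..p. evec T (l ! j) (l ! (j + 1)) / evec T (l ! j) (l ! j)))"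

end

theory Submission
  imports Defs
begin

text \<open>
  After the substitution the map \<open>G\<close> fixes the origin and its linear part is upper triangular. Hence
  in the graded lexicographic order the polynomial obtained from a monomial by substituting \<open>G\<close>
  contains, besides that monomial, only later ones: the infinite matrix \<open>T\<close> is upper triangular, its
  diagonal entries are products of powers of the eigenvalues, and the condition on the logarithms and
  arguments makes them pairwise distinct. The chain sums solve the recursions which say that the
  columns of \<open>evec T\<close> are eigenvectors of \<open>T\<close> and that \<open>evec_inv T\<close> is a right inverse of
  \<open>evec T\<close>. The inner sum over \<open>j\<close> is therefore an entry of \<open>T\<^sup>i\<close>; the rows of \<open>T\<^sup>i\<close> are
  finite because \<open>G\<close> is a polynomial map, so no question of convergence arises.
\<close>

section \<open>Diagonalization of infinite triangular matrices\<close>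

lemma finite_chains: "finite (chains p b a)"
proof (rule finite_subset)
  show "chains p b a \<subseteq> {ls. set ls \<subseteq> {..a} \<and> length ls = p + 2}"
  proof
    fix ls assume ls: "ls \<in> chains p b a"
    have "ls ! i \<le> a" if "i < p + 2" for i
      using ls that sorted_wrt_nth_less[of "(<)" ls i "p + 1"]
      by (cases "i = p + 1") (auto simp: chains_def)
    then show "ls \<in> {ls. set ls \<subseteq> {..a} \<and> length ls = p + 2}"
      using ls by (auto simp: chains_def in_set_conv_nth)
  qed
qed (simp add: finite_lists_length_eq)

lemma chains_0: "chains 0 b a = (if b < a then {[b, a]} else {})"
  by (auto simp: chains_def length_Suc_conv numeral_2_eq_2)

text \<open>Cutting off the starting point leaves a chain from the second point \<open>c\<close>
  with one inner point fewer. The recursion for chain sums rests on this decomposition.\<close>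

lemma chains_Suc: "chains (Suc p) b a = (\<Union>c\<in>{b<..}. (#) b ` chains p c a)"
proof (intro equalityI subsetI)
  fix ls assume ls: "ls \<in> chains (Suc p) b a"
  then obtain ms where ms: "ls = b # ms"
    by (cases ls) (auto simp: chains_def)
  have "length ms = p + 2"
    using ls by (simp add: chains_def ms)
  then have "b < ms ! 0" "ms \<in> chains p (ms ! 0) a"
    using ls by (auto simp: chains_def ms)
  then show "ls \<in> (\<Union>c\<in>{b<..}. (#) b ` chains p c a)"
    by (auto simp: ms)
next
  fix ls assume "ls \<in> (\<Union>c\<in>{b<..}. (#) b ` chains p c a)"
  then obtain c ms where ms: "ls = b # ms" "b < c" "ms \<in> chains p c a"
    by auto
  have "b < x" if x: "x \<in> set ms" for x
  proof -
    obtain i where i: "i < length ms" "x = ms ! i"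
      using x by (metis in_set_conv_nth)
    show ?thesis
      using ms i sorted_wrt_nth_less[of "(<)" ms 0 i] by (cases "i = 0") (auto simp: chains_def)
  qed
  then show "ls \<in> chains (Suc p) b a"
    using ms by (auto simp: chains_def)
qed

text \<open>Each of the \<open>p + 1\<close> steps of a chain climbs by at least one.\<close>

lemma chains_empty:
  assumes "a \<le> b + p"
  shows "chains p b a = {}"
  using assms
proof (induction p arbitrary: b)
  case (Suc p)
  have "chains p c a = {}" if "b < c" for c
    using Suc.prems that by (intro Suc.IH) simp
  then show ?case
    by (auto simp: chains_Suc)
qed (simp add: chains_0)

text \<open>Entry \<open>(b, a)\<close> of the Neumann series for the inverse of
  \<open>1 + N\<close>, where \<open>N\<close> is the strictly upper triangular part of
  \<open>W\<close>. For fixed \<open>a\<close>, both \<open>evec\<close> and \<open>evec_inv\<close>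
  are instances, with weights that absorb the denominators.\<close>

definition chain_sum :: "(nat \<Rightarrow> nat \<Rightarrow> complex) \<Rightarrow> nat \<Rightarrow> nat \<Rightarrow> complex" where
  "chain_sum W b a =
     (if b > a then 0 else if b = a then 1
      else \<Sum>p = 0..a - b - 1. \<Sum>l\<in>chains p b a.
        (- 1) ^ (p + 1) * (\<Prod>j = 0..p. W (l ! j) (l ! (j + 1))))"

text \<open>The limit \<open>a - b - 1\<close> depends on the starting point. Longer chains do not
  exist, so one limit can serve all starting points.\<close>

lemma chain_sum_extend:
  assumes "b < a" "a \<le> b + n"
  shows "chain_sum W b a = (\<Sum>p<n. \<Sum>l\<in>chains p b a.
    (- 1) ^ (p + 1) * (\<Prod>j = 0..p. W (l ! j) (l ! (j + 1))))"
proof -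
  have "{0..a - b - 1} = {..<a - b}"
    using assms by auto
  then have "chain_sum W b a = (\<Sum>p<a - b. \<Sum>l\<in>chains p b a.
      (- 1) ^ (p + 1) * (\<Prod>j = 0..p. W (l ! j) (l ! (j + 1))))"
    using assms by (simp add: chain_sum_def)
  also have "\<dots> = (\<Sum>p<n. \<Sum>l\<in>chains p b a.
      (- 1) ^ (p + 1) * (\<Prod>j = 0..p. W (l ! j) (l ! (j + 1))))"
    using assms by (intro sum.mono_neutral_left) (auto simp: chains_empty)
  finally show ?thesis .
qed

text \<open>The chains are sorted by their second point \<open>c\<close>. In matrix form this is
  \<open>(1 + N) X = 1\<close> off the diagonal; the term \<open>c = a\<close> is the chain without
  inner points.\<close>

lemma chain_sum_rec:
  assumes "b < a"
  shows "chain_sum W b a = - (\<Sum>c\<in>{b<..a}. W b c * chain_sum W c a)"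
proof -
  define h :: "nat \<Rightarrow> nat list \<Rightarrow> complex" where
    "h p l = (- 1) ^ (p + 1) * (\<Prod>j = 0..p. W (l ! j) (l ! (j + 1)))" for p l
  have ext: "chain_sum W c a = (\<Sum>p<n. \<Sum>l\<in>chains p c a. h p l)" if "c < a" "a \<le> c + n" for c n
    unfolding h_def using that by (rule chain_sum_extend)
  have h_Cons: "h (Suc p) (b # ms) = - (W b c * h p ms)" if "ms \<in> chains p c a" for p c ms
  proof -
    have "(\<Prod>j = 0..Suc p. W ((b # ms) ! j) ((b # ms) ! (j + 1))) =
        W b (ms ! 0) * (\<Prod>j = 0..p. W (ms ! j) (ms ! (j + 1)))"
      by (subst prod.atLeast0_atMost_Suc_shift) simp
    then show ?thesis
      using that by (simp add: h_def chains_def)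
  qed
  have step: "(\<Sum>l\<in>chains (Suc p) b a. h (Suc p) l)
      = - (\<Sum>c\<in>{b<..<a}. W b c * (\<Sum>l\<in>chains p c a. h p l))" for p
  proof -
    have "chains (Suc p) b a = (\<Union>c\<in>{b<..<a}. (#) b ` chains p c a)"
      unfolding chains_Suc
    proof (intro equalityI subsetI)
      fix ls assume "ls \<in> (\<Union>c\<in>{b<..}. (#) b ` chains p c a)"
      then obtain c ms where ls: "ls = b # ms" "b < c" "ms \<in> chains p c a"
        by auto
      moreover have "c < a"
        using chains_empty[of a c p] ls(3) by (cases "c < a") auto
      ultimately show "ls \<in> (\<Union>c\<in>{b<..<a}. (#) b ` chains p c a)"
        by auto
    qed auto
    then have "(\<Sum>l\<in>chains (Suc p) b a. h (Suc p) l) =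
        (\<Sum>c\<in>{b<..<a}. \<Sum>l\<in>(#) b ` chains p c a. h (Suc p) l)"
      by (simp only:) (rule sum.UNION_disjoint, simp, simp add: finite_chains, auto simp: chains_def)
    also have "\<dots> = (\<Sum>c\<in>{b<..<a}. \<Sum>l\<in>chains p c a. - (W b c * h p l))"
    proof (rule sum.cong)
      fix c
      have "(\<Sum>l\<in>(#) b ` chains p c a. h (Suc p) l) = (\<Sum>l\<in>chains p c a. h (Suc p) (b # l))"
        by (simp add: sum.reindex)
      also have "\<dots> = (\<Sum>l\<in>chains p c a. - (W b c * h p l))"
        by (intro sum.cong refl h_Cons)
      finally show "(\<Sum>l\<in>(#) b ` chains p c a. h (Suc p) l) = (\<Sum>l\<in>chains p c a. - (W b c * h p l))" .
    qed simp
    finally show ?thesis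
      by (simp add: sum_distrib_left sum_negf)
  qed
  \<comment> \<open>The limits \<open>Suc a\<close> here and \<open>a\<close> for every
    \<open>c\<close> suffice for all chains and do not depend on \<open>c\<close>, so the two sums
    can be exchanged.\<close>
  have "chain_sum W b a = (\<Sum>p<Suc a. \<Sum>l\<in>chains p b a. h p l)"
    using assms by (intro ext) auto
  also have "\<dots> = - W b a + (\<Sum>p<a. \<Sum>l\<in>chains (Suc p) b a. h (Suc p) l)"
    using assms by (subst sum.lessThan_Suc_shift) (simp add: chains_0 h_def)
  also have "(\<Sum>p<a. \<Sum>l\<in>chains (Suc p) b a. h (Suc p) l)
      = - (\<Sum>p<a. \<Sum>c\<in>{b<..<a}. W b c * (\<Sum>l\<in>chains p c a. h p l))"
    by (simp only: step sum_negf)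
  also have "\<dots> = - (\<Sum>c\<in>{b<..<a}. W b c * (\<Sum>p<a. \<Sum>l\<in>chains p c a. h p l))"
    by (subst sum.swap) (simp add: sum_distrib_left)
  also have "\<dots> = - (\<Sum>c\<in>{b<..<a}. W b c * chain_sum W c a)"
    by (simp add: ext[of _ a])
  also have "- W b a + \<dots> = - (\<Sum>c\<in>{b<..a}. W b c * chain_sum W c a)"
  proof -
    have "{b<..a} = insert a {b<..<a}"
      using assms by auto
    then show ?thesis
      by (simp add: chain_sum_def)
  qed
  finally show ?thesis .
qed

section \<open>Eigenvectors, the inverse matrix and powers\<close>

lemma evec_eq_0: "b > a \<Longrightarrow> evec T b a = 0"
  and evec_diag: "evec T a a = 1"
  by (simp_all add: evec_def)

text \<open>The weights involve the end point \<open>a\<close>, but the recursion keeps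
  \<open>a\<close> fixed and moves only the starting point, so \<open>chain_sum_rec\<close>
  applies.\<close>

lemma evec_rec:
  assumes "b < a"
  shows "evec T b a = - (\<Sum>c\<in>{b<..a}. T b c / (T b b - T a a) * evec T c a)"
proof -
  have "evec T c a = chain_sum (\<lambda>i j. T i j / (T i i - T a a)) c a" for c
    by (simp add: evec_def chain_sum_def)
  then show ?thesis
    using chain_sum_rec[OF assms, of "\<lambda>i j. T i j / (T i i - T a a)"] by simp
qed

lemma evec_inv_rec:
  assumes "b < a"
  shows "evec_inv T b a = - (\<Sum>c\<in>{b<..a}. evec T b c * evec_inv T c a)"
proof -
  have "evec_inv T c a = chain_sum (\<lambda>i j. evec T i j) c a" for c
    by (simp add: evec_inv_def chain_sum_def evec_diag)
  then show ?thesis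
    using chain_sum_rec[OF assms, of "\<lambda>i j. evec T i j"] by simp
qed

lemma sum_atMost_split:
  fixes f :: "nat \<Rightarrow> complex"
  assumes "b \<le> a" "\<And>c. c < b \<Longrightarrow> f c = 0"
  shows "(\<Sum>c\<le>a. f c) = f b + (\<Sum>c\<in>{b<..a}. f c)"
proof -
  have "(\<Sum>c\<le>a. f c) = (\<Sum>c\<in>insert b {b<..a}. f c)"
    using assms by (intro sum.mono_neutral_right) (auto simp: not_less le_less)
  then show ?thesis
    by simp
qed

text \<open>This is \<open>evec_inv_rec\<close> with the diagonal term \<open>c = b\<close> moved to
  the other side. Terms with \<open>c > a\<close> vanish, so the finite sum is a full entry of the
  matrix product.\<close>

lemma evec_inv_right:
  "(\<Sum>c\<le>a. evec T b c * evec_inv T c a) = (if b = a then 1 else 0)"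
proof (cases "b \<le> a")
  case True
  then have "(\<Sum>c\<le>a. evec T b c * evec_inv T c a)
      = evec_inv T b a + (\<Sum>c\<in>{b<..a}. evec T b c * evec_inv T c a)"
    by (subst sum_atMost_split[of b]) (auto simp: evec_eq_0 evec_diag)
  then show ?thesis
    using True evec_inv_rec[of b a T] by (cases "b = a") (auto simp: evec_inv_def)
qed (auto simp: evec_eq_0 intro!: sum.neutral)

text \<open>Multiplying \<open>evec_rec\<close> by \<open>T b b - T a a\<close>, which is nonzero
  for \<open>b < a\<close>, turns it into row \<open>b\<close> of the eigenvalue equation.\<close>

lemma evec_eigenvector:
  assumes upper: "\<And>i j. i > j \<Longrightarrow> T i j = 0"
    and distinct: "\<And>i. i < a \<Longrightarrow> T i i \<noteq> T a a"
  shows "(\<Sum>c\<le>a. T b c * evec T c a) = evec T b a * T a a"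
proof (cases "b \<le> a")
  case True
  then have split: "(\<Sum>c\<le>a. T b c * evec T c a)
      = T b b * evec T b a + (\<Sum>c\<in>{b<..a}. T b c * evec T c a)"
    using upper by (intro sum_atMost_split) auto
  show ?thesis
  proof (cases "b = a")
    case False
    then have "b < a" "T b b - T a a \<noteq> 0"
      using True distinct by auto
    then have "(\<Sum>c\<in>{b<..a}. T b c * evec T c a) = - ((T b b - T a a) * evec T b a)"
      unfolding evec_rec[OF \<open>b < a\<close>, of T]
      by (simp add: sum_distrib_left)
    then show ?thesis
      unfolding split by (simp add: algebra_simps)
  qed (use split in \<open>simp add: evec_diag\<close>)
qed (auto simp: evec_eq_0 upper intro!: sum.neutral)

text \<open>Entry \<open>(b, a)\<close> of the \<open>i\<close>-th power of the infinite upper triangular matrix \<open>T\<close>.\<close>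

definition diag_power :: "(nat \<Rightarrow> nat \<Rightarrow> complex) \<Rightarrow> nat \<Rightarrow> nat \<Rightarrow> nat \<Rightarrow> complex" where
  "diag_power T i b a = (\<Sum>j\<le>a. evec T b j * T j j ^ i * evec_inv T j a)"

lemma diag_power_0: "diag_power T 0 b a = (if b = a then 1 else 0)"
  by (simp add: diag_power_def evec_inv_right)

lemma diag_power_eq_0: "b > a \<Longrightarrow> diag_power T i b a = 0"
  by (auto simp: diag_power_def evec_eq_0 intro!: sum.neutral)

text \<open>Write \<open>P\<close> for \<open>evec\<close>, \<open>Q\<close> for
  \<open>evec_inv\<close> and \<open>D\<close> for the diagonal of \<open>T\<close>. Then
  \<open>T P = P D\<close> gives \<open>P D^(i+1) Q = T (P D^i Q)\<close>, and all sums stop at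
  column \<open>a\<close>.\<close>

lemma diag_power_Suc:
  assumes upper: "\<And>i j. i > j \<Longrightarrow> T i j = 0"
    and distinct: "\<And>i j. i < j \<Longrightarrow> T i i \<noteq> T j j"
  shows "diag_power T (Suc i) b a = (\<Sum>c\<le>a. T b c * diag_power T i c a)"
proof -
  have eig: "evec T b j * T j j = (\<Sum>c\<le>a. T b c * evec T c j)" if "j \<le> a" for j
  proof -
    have "(\<Sum>c\<le>a. T b c * evec T c j) = (\<Sum>c\<le>j. T b c * evec T c j)"
      using that by (intro sum.mono_neutral_right) (auto simp: evec_eq_0)
    then show ?thesis
      using evec_eigenvector[of T j b, OF upper distinct] by simp
  qed
  have "diag_power T (Suc i) b a = (\<Sum>j\<le>a. (evec T b j * T j j) * (T j j ^ i * evec_inv T j a))"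
    by (simp add: diag_power_def mult_ac)
  also have "\<dots> = (\<Sum>j\<le>a. \<Sum>c\<le>a. T b c * (evec T c j * T j j ^ i * evec_inv T j a))"
    by (intro sum.cong refl, subst eig) (simp_all add: sum_distrib_right mult.assoc)
  also have "\<dots> = (\<Sum>c\<le>a. T b c * diag_power T i c a)"
    by (subst sum.swap) (simp add: diag_power_def sum_distrib_left)
  finally show ?thesis .
qed

text \<open>Induction on \<open>i\<close> for all rows at once: row \<open>b\<close> of
  \<open>T\<close> has finite support, so the series of the rows \<open>c\<close> in this support
  combine by finite linearity.\<close>

lemma diag_power_sums:
  fixes Y :: "nat \<Rightarrow> nat \<Rightarrow> complex"
  assumes upper: "\<And>i j. i > j \<Longrightarrow> T i j = 0"
    and distinct: "\<And>i j. i < j \<Longrightarrow> T i i \<noteq> T j j"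
    and finite: "\<And>b. finite {c. T b c \<noteq> 0}"
    and evolution: "\<And>i b. Y (Suc i) b = (\<Sum>c | T b c \<noteq> 0. T b c * Y i c)"
  shows "(\<lambda>a. diag_power T i b a * Y 0 a) sums Y i b"
proof (induction i arbitrary: b)
  case 0
  have "(\<lambda>a. diag_power T 0 b a * Y 0 a) = (\<lambda>a. if a = b then Y 0 a else 0)"
    by (auto simp: diag_power_0)
  then show ?case
    using sums_single[of b "Y 0"] by simp
next
  case (Suc i)
  have "(\<lambda>a. \<Sum>c | T b c \<noteq> 0. T b c * (diag_power T i c a * Y 0 a)) sums Y (Suc i) b"
    unfolding evolution by (intro sums_sum sums_mult Suc.IH)
  moreover have "(\<Sum>c | T b c \<noteq> 0. T b c * (diag_power T i c a * Y 0 a))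
      = diag_power T (Suc i) b a * Y 0 a" for a
  proof -
    \<comment> \<open>An index in only one of the two finite sets contributes zero: beyond
      \<open>a\<close> the factor \<open>diag_power T i c a\<close> vanishes, outside the support
      \<open>T b c\<close> does.\<close>
    have "(\<Sum>c\<le>a. T b c * diag_power T i c a) = (\<Sum>c | T b c \<noteq> 0. T b c * diag_power T i c a)"
      by (rule sum.mono_neutral_cong) (auto simp: diag_power_eq_0 not_le finite)
    then show ?thesis
      by (simp add: diag_power_Suc[OF upper distinct] sum_distrib_left mult_ac)
  qed
  ultimately show ?case
    by simp
qed

text \<open>The closed formula starts at column 1 and at \<open>j = 1\<close>. Since
  \<open>b > 0\<close>, both \<open>diag_power T i b 0\<close> and \<open>evec T b 0\<close> vanish,
  so nothing is lost by the shift to \<open>Suc l\<close>.\<close>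

lemma sums_without_0:
  fixes Y :: "nat \<Rightarrow> complex"
  assumes "(\<lambda>a. diag_power T i b a * Y a) sums S" "b > 0"
  shows "(\<lambda>l. \<Sum>j = 1..Suc l. evec T b j * T j j ^ i * evec_inv T j (Suc l) * Y (Suc l)) sums S"
proof -
  have "(\<lambda>l. diag_power T i b (Suc l) * Y (Suc l)) sums S"
    using assms by (subst sums_Suc_iff) (simp add: diag_power_eq_0)
  moreover have "diag_power T i b (Suc l) * Y (Suc l)
      = (\<Sum>j = 1..Suc l. evec T b j * T j j ^ i * evec_inv T j (Suc l) * Y (Suc l))" for l
  proof -
    have "diag_power T i b (Suc l) = (\<Sum>j = 1..Suc l. evec T b j * T j j ^ i * evec_inv T j (Suc l))"
      unfolding diag_power_def using assms(2)
      by (intro sum.mono_neutral_right) (auto simp: evec_eq_0 not_less_eq_eq)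
    then show ?thesis
      by (simp only: sum_distrib_right)
  qed
  ultimately show ?thesis
    by simp
qed

section \<open>Evaluation of polynomials\<close>

lemma exponents_Nil [simp]: "exponents [] = 0"
  and exponents_Cons: "exponents (l # ls) = Poly_Mapping.single l 1 + exponents ls"
  by (simp_all add: exponents_def)

lemma exponents_append: "exponents (xs @ ys) = exponents xs + exponents ys"
  by (simp add: exponents_def)

lemma lookup_exponents: "Poly_Mapping.lookup (exponents ls) i = count (mset ls) i"
  by (induction ls) (auto simp: exponents_Cons lookup_add lookup_single when_def)

lemma exponents_eq_iff: "exponents xs = exponents ys \<longleftrightarrow> mset xs = mset ys"
  by (simp add: poly_mapping_eq_iff fun_eq_iff multiset_eq_iff lookup_exponents)

lemma keys_exponents: "Poly_Mapping.keys (exponents ls) = set ls"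
  by (auto simp: in_keys_iff lookup_exponents count_eq_zero_iff)

lemma exponents_surj:
  obtains ls where "sorted ls" "exponents ls = e"
proof -
  define M where "M = Abs_multiset (Poly_Mapping.lookup e)"
  have M: "count M = Poly_Mapping.lookup e"
    unfolding M_def by (rule Abs_multiset_inverse) simp
  have "exponents (sorted_list_of_multiset M) = e"
    by (rule poly_mapping_eqI) (simp add: lookup_exponents M)
  then show thesis
    using that sorted_sorted_list_of_multiset by blast
qed

section \<open>Evaluation as a ring homomorphism\<close>

definition monom_value :: "(nat \<Rightarrow> complex) \<Rightarrow> (nat \<Rightarrow>\<^sub>0 nat) \<Rightarrow> complex" where
  "monom_value w e = (\<Prod>i\<in>Poly_Mapping.keys e. w i ^ Poly_Mapping.lookup e i)"

text \<open>A common finite index set lets the products for two exponent vectors be merged factor by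
  factor.\<close>

lemma monom_value_superset:
  assumes "finite S" "Poly_Mapping.keys e \<subseteq> S"
  shows "monom_value w e = (\<Prod>i\<in>S. w i ^ Poly_Mapping.lookup e i)"
  unfolding monom_value_def
  by (rule prod.mono_neutral_left) (use assms in \<open>auto simp: in_keys_iff\<close>)

lemma monom_value_add: "monom_value w (a + b) = monom_value w a * monom_value w b"
proof -
  define S where "S = Poly_Mapping.keys a \<union> Poly_Mapping.keys b"
  have "finite S" "Poly_Mapping.keys (a + b) \<subseteq> S"
    using keys_add[of a b] by (auto simp: S_def)
  then show ?thesis
    using monom_value_superset[of S]
    by (simp add: S_def lookup_add power_add prod.distrib)
qed

lemma monom_value_zero [simp]: "monom_value w 0 = 1"
  by (simp add: monom_value_def)

lemma monom_value_exponents: "monom_value w (exponents ls) = (\<Prod>l\<leftarrow>ls. w l)"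
  by (induction ls) (simp_all add: exponents_Cons monom_value_add, simp add: monom_value_def)

definition poly_value :: "(nat \<Rightarrow> complex) \<Rightarrow> cpoly \<Rightarrow> complex" where
  "poly_value w f = (\<Sum>e\<in>Poly_Mapping.keys f. Poly_Mapping.lookup f e * monom_value w e)"

lemma poly_value_superset:
  assumes "finite S" "Poly_Mapping.keys f \<subseteq> S"
  shows "poly_value w f = (\<Sum>e\<in>S. Poly_Mapping.lookup f e * monom_value w e)"
  unfolding poly_value_def
  by (rule sum.mono_neutral_left) (use assms in \<open>auto simp: in_keys_iff\<close>)

lemma poly_value_add: "poly_value w (f + g) = poly_value w f + poly_value w g"
proof -
  define S where "S = Poly_Mapping.keys f \<union> Poly_Mapping.keys g"
  have "finite S" "Poly_Mapping.keys (f + g) \<subseteq> S"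
    using keys_add[of f g] by (auto simp: S_def)
  then show ?thesis
    using poly_value_superset[of S]
    by (simp add: S_def lookup_add distrib_right sum.distrib)
qed

lemma poly_value_single: "poly_value w (Poly_Mapping.single e c) = c * monom_value w e"
  by (simp add: poly_value_def)

lemma poly_value_zero [simp]: "poly_value w 0 = 0"
  by (simp add: poly_value_def)

lemma poly_value_one [simp]: "poly_value w 1 = 1"
  using poly_value_single[of w 0 1] by simp

lemma poly_value_const: "poly_value w (const_poly c) = c"
  by (simp add: const_poly_def poly_value_single)

lemma poly_value_var: "poly_value w (var_poly p) = w p"
  by (simp add: var_poly_def poly_value_single monom_value_def)

lemma poly_value_diff: "poly_value w (f - g) = poly_value w f - poly_value w g"
  using poly_value_add[of w "f - g" g] by simp

lemma poly_value_sum: "poly_value w (\<Sum>i\<in>I. f i) = (\<Sum>i\<in>I. poly_value w (f i))"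
  by (induction I rule: infinite_finite_induct) (simp_all add: poly_value_add)

lemma poly_mapping_expand:
  "f = (\<Sum>e\<in>Poly_Mapping.keys f. Poly_Mapping.single e (Poly_Mapping.lookup f e))"
  by (rule poly_mapping_eqI)
    (auto simp: lookup_sum lookup_single when_def in_keys_iff)

lemma mult_expand:
  fixes f g :: cpoly
  shows "f * g = (\<Sum>a\<in>Poly_Mapping.keys f. \<Sum>b\<in>Poly_Mapping.keys g.
    Poly_Mapping.single (a + b) (Poly_Mapping.lookup f a * Poly_Mapping.lookup g b))"
proof -
  have "f * g = (\<Sum>a\<in>Poly_Mapping.keys f. Poly_Mapping.single a (Poly_Mapping.lookup f a)) *
      (\<Sum>b\<in>Poly_Mapping.keys g. Poly_Mapping.single b (Poly_Mapping.lookup g b))"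
    using poly_mapping_expand[of f] poly_mapping_expand[of g] by simp
  then show ?thesis
    by (simp add: sum_product mult_single)
qed

lemma poly_value_mult: "poly_value w (f * g) = poly_value w f * poly_value w g"
  by (simp add: mult_expand poly_value_sum poly_value_single monom_value_add
    poly_value_def[of w f] poly_value_def[of w g] sum_product mult_ac)

lemma poly_value_prod: "poly_value w (\<Prod>i\<in>I. f i) = (\<Prod>i\<in>I. poly_value w (f i))"
  by (induction I rule: infinite_finite_induct) (simp_all add: poly_value_mult)

lemma poly_value_prod_list: "poly_value w (\<Prod>i\<leftarrow>ls. f i) = (\<Prod>i\<leftarrow>ls. poly_value w (f i))"
  by (induction ls) (simp_all add: poly_value_mult)

section \<open>Polynomials in the first \<open>k\<close> variables and the enumeration of
  monomials\<close>

text \<open>The enumeration \<open>monomial_at k\<close> contains only monomials in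
  \<open>w_0, ..., w_(k-1)\<close>; this condition ensures that it covers every term of
  \<open>f\<close>.\<close>

definition vars_below :: "nat \<Rightarrow> cpoly \<Rightarrow> bool" where
  "vars_below k f \<longleftrightarrow> (\<forall>e\<in>Poly_Mapping.keys f. Poly_Mapping.keys e \<subseteq> {..<k})"

lemma vars_below_add:
  assumes "vars_below k f" "vars_below k g"
  shows "vars_below k (f + g)"
  using assms keys_add[of f g] unfolding vars_below_def by blast

lemma vars_below_diff:
  assumes "vars_below k f" "vars_below k g"
  shows "vars_below k (f - g)"
  using assms unfolding vars_below_def
  by (metis diff_zero in_keys_iff lookup_minus)

lemma vars_below_mult:
  assumes "vars_below k f" "vars_below k g"
  shows "vars_below k (f * g)"
  unfolding vars_below_def
proof
  fix e assume "e \<in> Poly_Mapping.keys (f * g)"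
  then obtain a b where "e = a + b" "a \<in> Poly_Mapping.keys f" "b \<in> Poly_Mapping.keys g"
    using keys_mult[of f g] by blast
  then show "Poly_Mapping.keys e \<subseteq> {..<k}"
    using assms keys_add[of a b] unfolding vars_below_def by blast
qed

lemma vars_below_const: "vars_below k (const_poly c)"
  by (simp add: vars_below_def const_poly_def)

lemma vars_below_var: "p < k \<Longrightarrow> vars_below k (var_poly p)"
  by (simp add: vars_below_def var_poly_def)

lemma vars_below_sum: "(\<And>i. i \<in> I \<Longrightarrow> vars_below k (f i)) \<Longrightarrow> vars_below k (\<Sum>i\<in>I. f i)"
  by (induction I rule: infinite_finite_induct)
    (simp_all add: vars_below_add, simp_all add: vars_below_def)

lemma vars_below_one: "vars_below k 1"
  by (simp add: vars_below_def)

lemma vars_below_prod: "(\<And>i. i \<in> I \<Longrightarrow> vars_below k (f i)) \<Longrightarrow> vars_below k (\<Prod>i\<in>I. f i)"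
  by (induction I rule: infinite_finite_induct) (simp_all add: vars_below_mult vars_below_one)

lemma vars_below_prod_list:
  "(\<And>i. vars_below k (f i)) \<Longrightarrow> vars_below k (\<Prod>i\<leftarrow>ls. f i)"
  by (induction ls) (simp_all add: vars_below_mult vars_below_one)

lemma vars_below_affine: "vars_below k (affine_poly k A B q)"
  unfolding affine_poly_def
  by (intro vars_below_add vars_below_sum vars_below_mult vars_below_const vars_below_var) simp

lemma vars_below_G: "vars_below k (G_poly k m C A A' B p)"
  unfolding G_poly_def F_poly_def
  by (intro vars_below_add vars_below_sum vars_below_mult vars_below_const vars_below_prod
    vars_below_diff vars_below_affine)

text \<open>Sorted lists correspond to multisets, hence to exponent vectors, and
  \<open>monomial_at k\<close> enumerates the sorted lists with entries below \<open>k\<close>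
  without repetition.\<close>

lemma bij_betw_exponents_monomial_at:
  assumes "k \<ge> 1"
  shows "bij_betw (\<lambda>c. exponents (monomial_at k c)) UNIV {e. Poly_Mapping.keys e \<subseteq> {..<k}}"
proof (rule bij_betwI')
  fix c d
  have "sorted (monomial_at k c)" "sorted (monomial_at k d)"
    using monomial_at(1)[OF assms] by (auto simp: monomials_def)
  then have "exponents (monomial_at k c) = exponents (monomial_at k d)
      \<longleftrightarrow> monomial_at k c = monomial_at k d"
    unfolding exponents_eq_iff by (metis properties_for_sort)
  then show "exponents (monomial_at k c) = exponents (monomial_at k d) \<longleftrightarrow> c = d"
    using monomial_at(2)[OF assms] by metis
next
  fix c
  show "exponents (monomial_at k c) \<in> {e. Poly_Mapping.keys e \<subseteq> {..<k}}"
    using monomial_at(1)[OF assms, of c] by (auto simp: monomials_def keys_exponents)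
next
  fix e :: "nat \<Rightarrow>\<^sub>0 nat" assume e: "e \<in> {e. Poly_Mapping.keys e \<subseteq> {..<k}}"
  obtain ls where ls: "sorted ls" "exponents ls = e"
    by (rule exponents_surj)
  then have "ls \<in> monomials k"
    using e by (auto simp: monomials_def keys_exponents)
  then have "ls = monomial_at k (monomial_rank k ls)"
    using inj_onD[OF inj_on_monomial_rank] monomial_at[OF assms] by metis
  then show "\<exists>c\<in>UNIV. e = exponents (monomial_at k c)"
    using ls(2) by (metis UNIV_I)
qed

text \<open>The terms of \<open>f\<close> are reindexed along the enumeration of monomials. For a
  substituted monomial this gives a finite row of the transition matrix and one entry of the
  evolution of the auxiliary vector.\<close>

lemma poly_value_rows:
  assumes "k \<ge> 1" "vars_below k f"
  defines "t \<equiv> \<lambda>c. Poly_Mapping.lookup f (exponents (monomial_at k c))"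
  shows "finite {c. t c \<noteq> 0}"
    and "poly_value w f = (\<Sum>c | t c \<noteq> 0. t c * (\<Prod>p\<leftarrow>monomial_at k c. w p))"
proof -
  let ?e = "\<lambda>c. exponents (monomial_at k c)"
  have bij: "bij_betw ?e {c. t c \<noteq> 0} (Poly_Mapping.keys f)"
  proof (rule bij_betw_subset[OF bij_betw_exponents_monomial_at[OF assms(1)]])
    show "?e ` {c. t c \<noteq> 0} = Poly_Mapping.keys f"
    proof (intro equalityI subsetI)
      fix e assume e: "e \<in> Poly_Mapping.keys f"
      then have "e \<in> {e. Poly_Mapping.keys e \<subseteq> {..<k}}"
        using assms(2) by (auto simp: vars_below_def)
      then obtain c where "e = ?e c"
        using bij_betw_exponents_monomial_at[OF assms(1)] unfolding bij_betw_def by blast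
      then show "e \<in> ?e ` {c. t c \<noteq> 0}"
        using e by (auto simp: t_def in_keys_iff)
    qed (auto simp: t_def in_keys_iff)
  qed simp
  show "finite {c. t c \<noteq> 0}"
    using bij_betw_finite[OF bij] by simp
  show "poly_value w f = (\<Sum>c | t c \<noteq> 0. t c * (\<Prod>p\<leftarrow>monomial_at k c. w p))"
    unfolding poly_value_def
    by (subst sum.reindex_bij_betw[OF bij, symmetric]) (simp add: t_def monom_value_exponents)
qed

section \<open>Initial monomials in the graded lexicographic order\<close>

definition total_degree :: "(nat \<Rightarrow>\<^sub>0 nat) \<Rightarrow> nat" where
  "total_degree e = Sum_any (Poly_Mapping.lookup e)"

lemma total_degree_add: "total_degree (a + b) = total_degree a + total_degree b"
  by (simp add: total_degree_def lookup_add Sum_any.distrib)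

lemma total_degree_single: "total_degree (Poly_Mapping.single l n) = n"
  by (simp add: total_degree_def lookup_single eq_commute[of l])

lemma total_degree_exponents: "total_degree (exponents ls) = length ls"
  by (induction ls)
    (simp_all add: exponents_Cons total_degree_add total_degree_single, simp add: total_degree_def)

text \<open>Listing the variables of a monomial in increasing order reverses
  the lexicographic comparison of the exponents, hence \<open>a > b\<close>.\<close>

definition glex :: "(nat \<Rightarrow>\<^sub>0 nat) \<Rightarrow> (nat \<Rightarrow>\<^sub>0 nat) \<Rightarrow> bool" where
  "glex a b \<longleftrightarrow> total_degree a < total_degree b \<or> total_degree a = total_degree b \<and> a > b"

lemma glex_irrefl: "\<not> glex a a"
  by (simp add: glex_def)

lemma glex_trans: "glex a b \<Longrightarrow> glex b c \<Longrightarrow> glex a c"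
  by (auto simp: glex_def)

lemma glex_add_right: "glex (a + c) (b + c) \<longleftrightarrow> glex a b"
  by (simp add: glex_def total_degree_add)

lemma glex_add_left: "glex (c + a) (c + b) \<longleftrightarrow> glex a b"
  by (simp add: add.commute[of c] glex_add_right)

text \<open>The order on \<open>poly_mapping\<close> is decided at the least index where the
  arguments differ. Here that index is \<open>x\<close>, absent from \<open>y # ys\<close> because
  all entries of that list exceed \<open>x\<close>.\<close>

lemma exponents_less:
  assumes "sorted (y # ys)" "sorted (x # xs)" "x < y"
  shows "exponents (y # ys) < exponents (x # xs)"
proof -
  have "count (mset (y # ys)) i = 0" if "i \<le> x" for i
    using assms that by (subst count_eq_zero_iff) auto
  moreover have "count (mset (x # xs)) i = 0" if "i < x" for i
    using assms that by (subst count_eq_zero_iff) auto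
  moreover have "count (mset (x # xs)) x > 0"
    by simp
  ultimately have "less_fun (Poly_Mapping.lookup (exponents (y # ys)))
      (Poly_Mapping.lookup (exponents (x # xs)))"
    unfolding less_fun_def lookup_exponents by (intro exI[of _ x]) simp
  then show ?thesis
    by (simp add: less_poly_mapping.rep_eq)
qed

text \<open>For equal lengths, removing the common prefix leaves lists with different heads, and the
  smaller head has the larger exponent vector by \<open>exponents_less\<close>. Adding the prefix
  back preserves the order.\<close>

lemma lenlex_imp_glex:
  assumes "(ms, ls) \<in> lenlex less_than" "sorted ms" "sorted ls"
  shows "glex (exponents ms) (exponents ls)"
proof (cases "length ms < length ls")
  case False
  then have "length ms = length ls" "(ms, ls) \<in> lex less_than"
    using assms(1) by (auto simp: lenlex_conv)
  then obtain zs x xs y ys where *: "ms = zs @ x # xs" "ls = zs @ y # ys" "x < y"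
    by (auto simp: lex_conv)
  then have "exponents (y # ys) < exponents (x # xs)"
    using assms(2,3) by (intro exponents_less) (simp_all add: sorted_append)
  then have "exponents ls < exponents ms"
    by (simp add: * exponents_append)
  then show ?thesis
    using \<open>length ms = length ls\<close> by (simp add: glex_def total_degree_exponents)
qed (simp add: glex_def total_degree_exponents)

text \<open>Mirror image of a leading term: \<open>e\<close> is the least monomial that can occur in
  \<open>f\<close>. The coefficient \<open>c\<close> may be zero, which frees products from side
  conditions.\<close>

definition initial :: "cpoly \<Rightarrow> (nat \<Rightarrow>\<^sub>0 nat) \<Rightarrow> complex \<Rightarrow> bool" where
  "initial f e c \<longleftrightarrow> Poly_Mapping.lookup f e = c \<and> (\<forall>a\<in>Poly_Mapping.keys f. a = e \<or> glex e a)"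

lemma initial_one: "initial 1 0 1"
  by (simp add: initial_def)

text \<open>Split off the terms at \<open>a\<close> and \<open>b\<close>, leaving \<open>f'\<close>
  and \<open>g'\<close>. The rest \<open>r\<close> of the product has only monomials strictly later
  than \<open>a + b\<close>, because \<open>glex\<close> is compatible with addition.\<close>

lemma initial_mult:
  assumes f: "initial f a c" and g: "initial g b d"
  shows "initial (f * g) (a + b) (c * d)"
proof -
  define f' where "f' = f - Poly_Mapping.single a c"
  define g' where "g' = g - Poly_Mapping.single b d"
  have f': "glex a x" if "x \<in> Poly_Mapping.keys f'" for x
    using that f by (cases "x = a") (auto simp: f'_def initial_def in_keys_iff lookup_minus lookup_single when_def)
  have g': "glex b x" if "x \<in> Poly_Mapping.keys g'" for x
    using that g by (cases "x = b") (auto simp: g'_def initial_def in_keys_iff lookup_minus lookup_single when_def)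
  define r where "r = Poly_Mapping.single a c * g' + f' * g"
  have fg: "f * g = Poly_Mapping.single (a + b) (c * d) + r"
    by (simp add: r_def f'_def g'_def mult_single[symmetric] algebra_simps)
  have r: "glex (a + b) x" if x: "x \<in> Poly_Mapping.keys r" for x
  proof -
    consider "x \<in> Poly_Mapping.keys (Poly_Mapping.single a c * g')" | "x \<in> Poly_Mapping.keys (f' * g)"
      using x keys_add[of "Poly_Mapping.single a c * g'" "f' * g"] by (auto simp: r_def)
    then show ?thesis
    proof cases
      case 1
      then obtain y z where yz: "x = y + z" "y \<in> Poly_Mapping.keys (Poly_Mapping.single a c)"
          "z \<in> Poly_Mapping.keys g'"
        using keys_mult[of "Poly_Mapping.single a c" g'] by blast
      then have "y = a"
        by (cases "c = 0") auto
      then show ?thesis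
        using yz g' by (simp add: glex_add_left)
    next
      case 2
      then obtain y z where yz: "x = y + z" "y \<in> Poly_Mapping.keys f'" "z \<in> Poly_Mapping.keys g"
        using keys_mult[of f' g] by blast
      then have "glex (a + b) (y + b)"
        using f' by (simp add: glex_add_right)
      moreover have "y + b = y + z \<or> glex (y + b) (y + z)"
        using g yz(3) by (auto simp: initial_def glex_add_left)
      ultimately show ?thesis
        unfolding yz(1) using glex_trans by metis
    qed
  qed
  have "Poly_Mapping.lookup r (a + b) = 0"
    using r[of "a + b"] glex_irrefl[of "a + b"] unfolding in_keys_iff by metis
  then have "Poly_Mapping.lookup (f * g) (a + b) = c * d"
    by (simp add: fg lookup_add)
  moreover have "x = a + b \<or> glex (a + b) x" if x: "x \<in> Poly_Mapping.keys (f * g)" for x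
  proof -
    have "x \<in> Poly_Mapping.keys (Poly_Mapping.single (a + b) (c * d)) \<or> x \<in> Poly_Mapping.keys r"
      using x keys_add[of "Poly_Mapping.single (a + b) (c * d)" r] unfolding fg by blast
    then show ?thesis
      using r by (auto split: if_splits)
  qed
  ultimately show ?thesis
    by (simp add: initial_def)
qed

lemma initial_prod_list:
  assumes "\<And>l. l \<in> set ls \<Longrightarrow> initial (f l) (exponents [l]) (d l)"
  shows "initial (\<Prod>l\<leftarrow>ls. f l) (exponents ls) (\<Prod>l\<leftarrow>ls. d l)"
  using assms
proof (induction ls)
  case (Cons l ls)
  then have "initial (f l * (\<Prod>l\<leftarrow>ls. f l)) (exponents [l] + exponents ls) (d l * (\<Prod>l\<leftarrow>ls. d l))"
    by (intro initial_mult) auto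
  then show ?case
    by (simp add: exponents_Cons)
qed (simp add: initial_one)

text \<open>Before the monomial \<open>w_l\<close> come only the constant and the \<open>w_x\<close>
  with \<open>x < l\<close>.\<close>

lemma initial_linear:
  assumes const: "Poly_Mapping.lookup f 0 = 0"
    and below: "\<And>x. x < l \<Longrightarrow> Poly_Mapping.lookup f (exponents [x]) = 0"
  shows "initial f (exponents [l]) (Poly_Mapping.lookup f (exponents [l]))"
  unfolding initial_def
proof (intro conjI ballI refl)
  fix e assume e: "e \<in> Poly_Mapping.keys f"
  obtain ls where ls: "sorted ls" "exponents ls = e"
    by (rule exponents_surj)
  consider "ls = []" | x where "ls = [x]" | "length ls \<ge> 2"
    by (cases ls rule: remdups_adj.cases) auto
  then show "e = exponents [l] \<or> glex (exponents [l]) e"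
  proof cases
    case 1
    then show ?thesis
      using e const ls by (auto simp: in_keys_iff)
  next
    case 2
    then have "x \<ge> l"
      using e below[of x] ls by (auto simp: in_keys_iff simp flip: not_less)
    then show ?thesis
      using exponents_less[of x "[]" l "[]"] 2 ls
      by (cases "x = l") (auto simp: glex_def total_degree_exponents)
  next
    case 3
    then have "total_degree (exponents [l]) < total_degree e"
      unfolding ls(2)[symmetric] total_degree_exponents by simp
    then show ?thesis
      by (simp add: glex_def)
  qed
qed

section \<open>Triangularity and diagonal of the transition matrix\<close>

lemma lenlex_total: "(ms, ls) \<in> lenlex less_than \<or> ms = ls \<or> (ls, ms) \<in> lenlex less_than"
  for ms ls :: "nat list"
proof -
  have "total (lenlex (less_than :: (nat \<times> nat) set))"
    by (rule total_lenlex) (simp add: total_on_def, linarith)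
  then show ?thesis
    by (auto simp: total_on_def)
qed

text \<open>The rank increases strictly along the order; totality of the order gives the
  converse.\<close>

lemma lenlex_monomial_at:
  assumes "k \<ge> 1" "b < a"
  shows "(monomial_at k b, monomial_at k a) \<in> lenlex less_than"
  using assms lenlex_total[of "monomial_at k b" "monomial_at k a"] monomial_at[OF assms(1)]
    monomial_rank_less[of "monomial_at k a" k "monomial_at k b"]
  by (metis less_asym less_irrefl)

text \<open>By multiplicativity of \<open>initial\<close>, the polynomial expanded in row
  \<open>a\<close> has no monomial earlier than monomial \<open>a\<close>, and monomial
  \<open>b\<close> is strictly earlier.\<close>

lemma transition_upper:
  assumes k: "k \<ge> 1" and "b < a"
    and initial: "\<And>l. l < k \<Longrightarrow> initial (G_poly k m C A A' B l) (exponents [l]) (d l)"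
  shows "transition k m C A A' B a b = 0"
proof (rule ccontr)
  let ?f = "\<Prod>l\<leftarrow>monomial_at k a. G_poly k m C A A' B l"
  have mon: "monomial_at k a \<in> monomials k" "monomial_at k b \<in> monomials k"
    using monomial_at(1)[OF k] by auto
  then have glex: "glex (exponents (monomial_at k b)) (exponents (monomial_at k a))"
    using lenlex_monomial_at[OF k \<open>b < a\<close>] by (intro lenlex_imp_glex) (auto simp: monomials_def)
  assume "transition k m C A A' B a b \<noteq> 0"
  then have "exponents (monomial_at k b) \<in> Poly_Mapping.keys ?f"
    by (simp add: transition_def in_keys_iff)
  moreover have "initial ?f (exponents (monomial_at k a)) (\<Prod>l\<leftarrow>monomial_at k a. d l)"
    using mon(1) by (intro initial_prod_list initial) (auto simp: monomials_def)
  ultimately show False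
    using glex glex_trans glex_irrefl by (metis initial_def)
qed

lemma transition_diag:
  assumes k: "k \<ge> 1"
    and initial: "\<And>l. l < k \<Longrightarrow> initial (G_poly k m C A A' B l) (exponents [l]) (d l)"
  shows "transition k m C A A' B a a = (\<Prod>l\<leftarrow>monomial_at k a. d l)"
proof -
  have "initial (\<Prod>l\<leftarrow>monomial_at k a. G_poly k m C A A' B l) (exponents (monomial_at k a))
      (\<Prod>l\<leftarrow>monomial_at k a. d l)"
    using monomial_at(1)[OF k, of a] by (intro initial_prod_list initial) (auto simp: monomials_def)
  then show ?thesis
    by (simp add: initial_def transition_def)
qed

text \<open>The monomials before \<open>[p]\<close> are \<open>[]\<close> and the \<open>[x]\<close>
  with \<open>x < p\<close>, in total \<open>p + 1\<close>. Thus entry \<open>p + 1\<close> of the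
  auxiliary vector is component \<open>p\<close> of the state.\<close>

lemma monomial_at_Suc:
  assumes "p < k"
  shows "monomial_at k (Suc p) = [p]"
proof -
  have k: "k \<ge> 1"
    using assms by simp
  have "{ms \<in> monomials k. (ms, [p]) \<in> lenlex less_than} = insert [] ((\<lambda>x. [x]) ` {..<p})"
    using assms by (auto simp: monomials_def lenlex_conv length_Suc_conv image_iff less_Suc_eq)
  then have "monomial_rank k [p] = Suc p"
    by (simp add: monomial_rank_def card_image inj_on_def image_iff)
  moreover have "[p] \<in> monomials k"
    using assms by (simp add: monomials_def)
  ultimately show ?thesis
    using monomial_at[OF k, of "Suc p"] inj_onD[OF inj_on_monomial_rank[of k]] by metis
qed

section \<open>Linear parts and symmetrization\<close>

text \<open>Since \<open>P\<close> lists all decompositions of the exponent \<open>e\<close>, the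
  convolution becomes a sum over a set that does not depend on \<open>f\<close> and
  \<open>g\<close>.\<close>

lemma lookup_mult_pairs:
  fixes f g :: cpoly
  assumes P: "finite P" "\<And>a b. a + b = e \<longleftrightarrow> (a, b) \<in> P"
  shows "Poly_Mapping.lookup (f * g) e =
    (\<Sum>(a, b)\<in>P. Poly_Mapping.lookup f a * Poly_Mapping.lookup g b)"
proof -
  let ?K = "Poly_Mapping.keys f \<times> Poly_Mapping.keys g"
  have "Poly_Mapping.lookup (f * g) e = (\<Sum>(a, b)\<in>?K.
      if (a, b) \<in> P then Poly_Mapping.lookup f a * Poly_Mapping.lookup g b else 0)"
    by (auto simp: mult_expand lookup_sum lookup_single when_def sum.cartesian_product P(2)
        intro!: sum.cong)
  also have "\<dots> = (\<Sum>(a, b)\<in>?K \<inter> P. Poly_Mapping.lookup f a * Poly_Mapping.lookup g b)"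
    by (subst sum.inter_restrict) (auto intro!: sum.cong)
  also have "\<dots> = (\<Sum>(a, b)\<in>P. Poly_Mapping.lookup f a * Poly_Mapping.lookup g b)"
    by (rule sum.mono_neutral_left) (use P(1) in \<open>auto simp: in_keys_iff\<close>)
  finally show ?thesis .
qed

lemma lookup_mult_0:
  fixes f g :: cpoly
  shows "Poly_Mapping.lookup (f * g) 0 = Poly_Mapping.lookup f 0 * Poly_Mapping.lookup g 0"
proof -
  have "a + b = 0 \<longleftrightarrow> (a, b) \<in> {(0, 0)}" for a b :: "nat \<Rightarrow>\<^sub>0 nat"
    by (auto simp: poly_mapping_eq_iff lookup_add fun_eq_iff)
  from lookup_mult_pairs[OF _ this] show ?thesis
    by simp
qed

lemma exponents_single_neq_0: "exponents [x] \<noteq> 0"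
  using exponents_eq_iff[of "[x]" "[]"] by simp

text \<open>Product rule at the origin: a single variable factors only as itself times the constant
  monomial, which is seen on multisets.\<close>

lemma lookup_mult_linear:
  fixes f g :: cpoly
  shows "Poly_Mapping.lookup (f * g) (exponents [x]) =
    Poly_Mapping.lookup f 0 * Poly_Mapping.lookup g (exponents [x]) +
    Poly_Mapping.lookup f (exponents [x]) * Poly_Mapping.lookup g 0"
proof -
  have "a + b = exponents [x] \<longleftrightarrow> (a, b) \<in> {(0, exponents [x]), (exponents [x], 0)}"
    for a b :: "nat \<Rightarrow>\<^sub>0 nat"
  proof -
    obtain la lb where l: "exponents la = a" "exponents lb = b"
      using exponents_surj by metis
    have "a + b = exponents [x] \<longleftrightarrow> mset la + mset lb = {#x#}"
      unfolding l[symmetric] exponents_append[symmetric] exponents_eq_iff by simp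
    also have "\<dots> \<longleftrightarrow> (a, b) \<in> {(0, exponents [x]), (exponents [x], 0)}"
      unfolding l[symmetric] exponents_Nil[symmetric]
      by (auto simp: exponents_eq_iff union_is_single simp del: exponents_Nil)
    finally show ?thesis .
  qed
  from lookup_mult_pairs[OF _ this, of f g] show ?thesis
    by (simp add: exponents_single_neq_0[symmetric])
qed

lemma lookup_one_linear: "Poly_Mapping.lookup (1 :: cpoly) (exponents [x]) = 0"
  by (simp add: lookup_one exponents_single_neq_0)

lemma lookup_const:
  "Poly_Mapping.lookup (const_poly c) 0 = c"
  "Poly_Mapping.lookup (const_poly c) (exponents [x]) = 0"
  by (auto simp: const_poly_def exponents_Cons lookup_single when_def poly_mapping_eq_iff fun_eq_iff)

lemma lookup_var:
  "Poly_Mapping.lookup (var_poly p) 0 = 0"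
  "Poly_Mapping.lookup (var_poly p) (exponents [x]) = (if p = x then 1 else 0)"
  by (auto simp: var_poly_def exponents_Cons lookup_single when_def poly_mapping_eq_iff fun_eq_iff)

lemma lookup_prod_0:
  fixes f :: "'i \<Rightarrow> cpoly"
  shows "Poly_Mapping.lookup (\<Prod>i\<in>I. f i) 0 = (\<Prod>i\<in>I. Poly_Mapping.lookup (f i) 0)"
  by (induction I rule: infinite_finite_induct) (simp_all add: lookup_mult_0)

lemma lookup_prod_linear:
  fixes f :: "'i \<Rightarrow> cpoly"
  assumes "finite I"
  shows "Poly_Mapping.lookup (\<Prod>i\<in>I. f i) (exponents [x]) =
    (\<Sum>t\<in>I. Poly_Mapping.lookup (f t) (exponents [x]) * (\<Prod>i\<in>I - {t}. Poly_Mapping.lookup (f i) 0))"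
  using assms
proof (induction I)
  case (insert j I)
  have "(\<Prod>i\<in>insert j I - {t}. Poly_Mapping.lookup (f i) 0)
      = Poly_Mapping.lookup (f j) 0 * (\<Prod>i\<in>I - {t}. Poly_Mapping.lookup (f i) 0)"
    if "t \<in> I" for t
  proof -
    have "insert j I - {t} = insert j (I - {t})"
      using insert.hyps that by auto
    then show ?thesis
      using insert.hyps by simp
  qed
  moreover have "insert j I - {j} = I"
    using insert.hyps by auto
  ultimately show ?case
    using insert by (simp add: lookup_mult_linear lookup_prod_0 sum_distrib_left mult_ac)
qed (simp add: lookup_one_linear)

section \<open>Averages over permutations of indices\<close>

lemma permute_list_index_lists:
  assumes "\<sigma> permutes {..<s}" "ls \<in> index_lists k s"
  shows "permute_list \<sigma> ls \<in> index_lists k s"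
  using assms by (simp add: index_lists_def)

lemma permute_list_inv:
  assumes "\<sigma> permutes {..<s}" "ls \<in> index_lists k s"
  shows "permute_list (Hilbert_Choice.inv \<sigma>) (permute_list \<sigma> ls) = ls"
    and "permute_list \<sigma> (permute_list (Hilbert_Choice.inv \<sigma>) ls) = ls"
proof -
  have \<sigma>: "\<sigma> permutes {..<length ls}" "Hilbert_Choice.inv \<sigma> permutes {..<length ls}"
    using assms permutes_inv by (auto simp: index_lists_def)
  show "permute_list (Hilbert_Choice.inv \<sigma>) (permute_list \<sigma> ls) = ls"
    using permute_list_compose[OF \<sigma>(2), of \<sigma>] permutes_inv_o[OF \<sigma>(1)] by simp
  show "permute_list \<sigma> (permute_list (Hilbert_Choice.inv \<sigma>) ls) = ls"
    using permute_list_compose[OF \<sigma>(1), of "Hilbert_Choice.inv \<sigma>"] permutes_inv_o[OF \<sigma>(1)] by simp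
qed

text \<open>Moves the permutation from the coefficient to the weight: for fixed
  \<open>\<sigma>\<close> the lists are reindexed by \<open>permute_list\<close>, and then
  \<open>\<sigma>\<close> is replaced by its inverse.\<close>

lemma sum_symmetrize:
  fixes c h :: "nat list \<Rightarrow> complex"
  shows "(\<Sum>ls\<in>index_lists k s. \<Sum>\<sigma> | \<sigma> permutes {..<s}. c (permute_list \<sigma> ls) * h ls) =
    (\<Sum>ls\<in>index_lists k s. c ls * (\<Sum>\<sigma> | \<sigma> permutes {..<s}. h (permute_list \<sigma> ls)))"
proof -
  have fin: "finite {\<sigma>. \<sigma> permutes {..<s}}"
    by (simp add: finite_permutations)
  have "(\<Sum>ls\<in>index_lists k s. \<Sum>\<sigma> | \<sigma> permutes {..<s}. c (permute_list \<sigma> ls) * h ls) =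
      (\<Sum>\<sigma> | \<sigma> permutes {..<s}. \<Sum>ls\<in>index_lists k s. c (permute_list \<sigma> ls) * h ls)"
    by (rule sum.swap)
  also have "\<dots> = (\<Sum>\<sigma> | \<sigma> permutes {..<s}. \<Sum>ls\<in>index_lists k s. c ls * h (permute_list (Hilbert_Choice.inv \<sigma>) ls))"
  proof (rule sum.cong[OF refl])
    fix \<sigma> assume "\<sigma> \<in> {\<sigma>. \<sigma> permutes {..<s}}"
    then have \<sigma>: "\<sigma> permutes {..<s}" "Hilbert_Choice.inv \<sigma> permutes {..<s}"
      using permutes_inv by auto
    show "(\<Sum>ls\<in>index_lists k s. c (permute_list \<sigma> ls) * h ls) =
        (\<Sum>ls\<in>index_lists k s. c ls * h (permute_list (Hilbert_Choice.inv \<sigma>) ls))"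
      by (rule sum.reindex_bij_witness[of _ "permute_list (Hilbert_Choice.inv \<sigma>)" "permute_list \<sigma>"])
        (use \<sigma> permute_list_inv[OF \<sigma>(1)] permute_list_index_lists[OF \<sigma>(1)]
          permute_list_index_lists[OF \<sigma>(2)] in auto)
  qed
  also have "\<dots> = (\<Sum>ls\<in>index_lists k s. \<Sum>\<sigma> | \<sigma> permutes {..<s}. c ls * h (permute_list (Hilbert_Choice.inv \<sigma>) ls))"
    by (rule sum.swap)
  also have "\<dots> = (\<Sum>ls\<in>index_lists k s. \<Sum>\<sigma> | \<sigma> permutes {..<s}. c ls * h (permute_list \<sigma> ls))"
    by (rule sum.cong[OF refl], rule sum.reindex_bij_witness[of _ Hilbert_Choice.inv Hilbert_Choice.inv])
      (auto simp: permutes_inv permutes_inv_inv)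
  finally show ?thesis
    by (simp add: sum_distrib_left)
qed

text \<open>Each \<open>t\<close> is the value \<open>\<sigma> 0\<close> for \<open>n!\<close>
  permutations. Instead of counting them, the proof averages over all \<open>n + 1\<close>
  positions.\<close>

lemma sum_permutes_at_0:
  fixes g :: "nat \<Rightarrow> complex"
  shows "(\<Sum>\<sigma> | \<sigma> permutes {..<Suc n}. g (\<sigma> 0)) = fact n * (\<Sum>t<Suc n. g t)"
proof -
  let ?S = "{\<sigma>. \<sigma> permutes {..<Suc n}}"
  have card: "card ?S = fact (Suc n)"
    using card_permutations[of "{..<Suc n}"] by simp
  \<comment> \<open>Composition with the transposition of \<open>0\<close> and \<open>t\<close>
    exchanges the values at these two positions.\<close>
  have at: "(\<Sum>\<sigma>\<in>?S. g (\<sigma> 0)) = (\<Sum>\<sigma>\<in>?S. g (\<sigma> t))" if "t < Suc n" for t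
  proof -
    have tr: "transpose 0 t permutes {..<Suc n}"
      using that by (intro permutes_swap_id) auto
    show ?thesis
      by (rule sum.reindex_bij_witness[of _ "\<lambda>\<sigma>. \<sigma> \<circ> transpose 0 t" "\<lambda>\<sigma>. \<sigma> \<circ> transpose 0 t"])
        (auto simp: o_assoc[symmetric] intro: permutes_compose[OF tr])
  qed
  have "(\<Sum>t<Suc n. \<Sum>\<sigma>\<in>?S. g (\<sigma> 0)) = (\<Sum>t<Suc n. \<Sum>\<sigma>\<in>?S. g (\<sigma> t))"
    by (rule sum.cong[OF refl], rule at) simp
  then have "of_nat (Suc n) * (\<Sum>\<sigma>\<in>?S. g (\<sigma> 0)) = (\<Sum>t<Suc n. \<Sum>\<sigma>\<in>?S. g (\<sigma> t))"
    by (simp only: sum_constant card_lessThan)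
  also have "\<dots> = (\<Sum>\<sigma>\<in>?S. \<Sum>t<Suc n. g (\<sigma> t))"
    by (rule sum.swap)
  also have "\<dots> = (\<Sum>\<sigma>\<in>?S. \<Sum>t<Suc n. g t)"
    by (rule sum.cong[OF refl], rule sum.reindex_bij_betw[OF permutes_imp_bij]) simp
  also have "\<dots> = of_nat (Suc n) * (fact n * (\<Sum>t<Suc n. g t))"
    by (simp only: sum_constant card) (simp add: algebra_simps)
  finally show ?thesis
    by (simp only: mult_cancel_left of_nat_eq_0_iff) simp
qed

lemma index_lists_Suc: "index_lists k (Suc n) = (\<lambda>(l, ls). l # ls) ` ({..<k} \<times> index_lists k n)"
  by (auto simp: index_lists_def length_Suc_conv image_iff)

text \<open>By the product rule, the right-hand side is the derivative at \<open>b\<close> in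
  direction \<open>a\<close> of the form of degree \<open>n + 1\<close> with coefficients
  \<open>c\<close>. The left-hand side is the symmetrized expression from
  \<open>linear_part\<close>, applied to \<open>a\<close>.\<close>

lemma derivative_symmetrized:
  fixes c :: "nat list \<Rightarrow> complex" and a b :: "nat \<Rightarrow> complex"
  shows "(\<Sum>l<k. \<Sum>ls\<in>index_lists k n. 1 / fact n *
      (\<Sum>\<sigma> | \<sigma> permutes {..<Suc n}. c (permute_list \<sigma> (l # ls)) * (\<Prod>t<n. b (ls ! t))) * a l) =
    (\<Sum>ls\<in>index_lists k (Suc n). c ls *
      (\<Sum>t<Suc n. a (ls ! t) * (\<Prod>r\<in>{..<Suc n} - {t}. b (ls ! r))))"
proof -
  \<comment> \<open>The weight \<open>h\<close> has the direction \<open>a\<close> in slot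
    \<open>0\<close>; permuting the list moves it to slot \<open>\<sigma> 0\<close>.\<close>
  define h where "h ls = a (ls ! 0) * (\<Prod>t<n. b (ls ! Suc t))" for ls
  have h: "h (permute_list \<sigma> ls) = a (ls ! \<sigma> 0) * (\<Prod>r\<in>{..<Suc n} - {\<sigma> 0}. b (ls ! r))"
    if "\<sigma> permutes {..<Suc n}" "ls \<in> index_lists k (Suc n)" for \<sigma> ls
  proof -
    have \<sigma>: "\<sigma> permutes {..<length ls}" "length ls = Suc n"
      using that by (auto simp: index_lists_def)
    have "bij_betw \<sigma> ({..<Suc n} - {0}) ({..<Suc n} - {\<sigma> 0})"
      using permutes_imp_bij[OF that(1)] permutes_in_image[OF that(1), of 0]
      by (intro bij_betw_DiffI) auto
    moreover have "bij_betw Suc {..<n} ({..<Suc n} - {0})"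
      unfolding lessThan_Suc_eq_insert_0 by (auto simp: bij_betw_def)
    ultimately have "bij_betw (\<sigma> \<circ> Suc) {..<n} ({..<Suc n} - {\<sigma> 0})"
      using bij_betw_trans by blast
    from prod.reindex_bij_betw[OF this, of "\<lambda>r. b (ls ! r)"] show ?thesis
      by (simp add: h_def permute_list_nth[OF \<sigma>(1)] \<sigma>(2))
  qed
  have "(\<Sum>l<k. \<Sum>ls\<in>index_lists k n. 1 / fact n *
      (\<Sum>\<sigma> | \<sigma> permutes {..<Suc n}. c (permute_list \<sigma> (l # ls)) * (\<Prod>t<n. b (ls ! t))) * a l) =
    1 / fact n * (\<Sum>l<k. \<Sum>ls\<in>index_lists k n. \<Sum>\<sigma> | \<sigma> permutes {..<Suc n}.
       c (permute_list \<sigma> (l # ls)) * h (l # ls))"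
    by (simp add: h_def sum_distrib_left sum_distrib_right sum_divide_distrib mult_ac)
  also have "(\<Sum>l<k. \<Sum>ls\<in>index_lists k n. \<Sum>\<sigma> | \<sigma> permutes {..<Suc n}.
       c (permute_list \<sigma> (l # ls)) * h (l # ls)) =
     (\<Sum>ls\<in>index_lists k (Suc n). \<Sum>\<sigma> | \<sigma> permutes {..<Suc n}. c (permute_list \<sigma> ls) * h ls)"
    unfolding index_lists_Suc
    by (subst sum.reindex) (auto simp: inj_on_def sum.cartesian_product')
  also have "\<dots> = (\<Sum>ls\<in>index_lists k (Suc n). c ls *
      (\<Sum>\<sigma> | \<sigma> permutes {..<Suc n}. h (permute_list \<sigma> ls)))"
    by (rule sum_symmetrize)
  also have "\<dots> = (\<Sum>ls\<in>index_lists k (Suc n). c ls *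
      (fact n * (\<Sum>t<Suc n. a (ls ! t) * (\<Prod>r\<in>{..<Suc n} - {t}. b (ls ! r)))))"
  proof (rule sum.cong[OF refl])
    fix ls assume ls: "ls \<in> index_lists k (Suc n)"
    have "(\<Sum>\<sigma> | \<sigma> permutes {..<Suc n}. h (permute_list \<sigma> ls)) =
        (\<Sum>\<sigma> | \<sigma> permutes {..<Suc n}. a (ls ! \<sigma> 0) * (\<Prod>r\<in>{..<Suc n} - {\<sigma> 0}. b (ls ! r)))"
      by (intro sum.cong refl h ls) simp
    then show "c ls * (\<Sum>\<sigma> | \<sigma> permutes {..<Suc n}. h (permute_list \<sigma> ls)) =
      c ls * (fact n * (\<Sum>t<Suc n. a (ls ! t) * (\<Prod>r\<in>{..<Suc n} - {t}. b (ls ! r))))"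
      by (simp only: sum_permutes_at_0[of "\<lambda>t. a (ls ! t) * (\<Prod>r\<in>{..<Suc n} - {t}. b (ls ! r))"])
  qed
  finally show ?thesis
    by (simp add: mult.left_commute[of _ "fact n"] flip: sum_distrib_left)
qed

text \<open>The product of the values of \<open>b\<close> is invariant under permutations, so once
  the permutation is moved off the coefficient, \<open>s!\<close> equal summands remain.\<close>

lemma value_symmetrized:
  fixes c :: "nat list \<Rightarrow> complex" and b :: "nat \<Rightarrow> complex"
  shows "1 / fact s * (\<Sum>ls\<in>index_lists k s. \<Sum>\<sigma> | \<sigma> permutes {..<s}.
      c (permute_list \<sigma> ls) * (\<Prod>t<s. b (ls ! t))) =
    (\<Sum>ls\<in>index_lists k s. c ls * (\<Prod>t<s. b (ls ! t)))"
proof -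
  have "(\<Prod>t<s. b (permute_list \<sigma> ls ! t)) = (\<Prod>t<s. b (ls ! t))"
    if "\<sigma> permutes {..<s}" "ls \<in> index_lists k s" for \<sigma> ls
  proof -
    have "\<sigma> permutes {..<length ls}" "length ls = s"
      using that by (auto simp: index_lists_def)
    then have "(\<Prod>t<s. b (permute_list \<sigma> ls ! t)) = (\<Prod>t<s. b (ls ! \<sigma> t))"
      by (simp add: permute_list_nth)
    also have "\<dots> = (\<Prod>t<s. b (ls ! t))"
      by (rule prod.reindex_bij_betw[OF permutes_imp_bij[OF that(1)]])
    finally show ?thesis .
  qed
  then have "(\<Sum>ls\<in>index_lists k s. c ls *
      (\<Sum>\<sigma> | \<sigma> permutes {..<s}. \<Prod>t<s. b (permute_list \<sigma> ls ! t))) =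
     (\<Sum>ls\<in>index_lists k s. c ls * (fact s * (\<Prod>t<s. b (ls ! t))))"
    using card_permutations[of "{..<s}" s] by (intro sum.cong refl) simp
  then show ?thesis
    by (simp add: sum_symmetrize[where h = "\<lambda>ls. \<Prod>t<s. b (ls ! t)"]
      mult.left_commute[of _ "fact s"] flip: sum_distrib_left)
qed

section \<open>Linearization of the transformed map at the origin\<close>

text \<open>Chain rule: the linear part of \<open>F(A w + B)\<close> at the origin is the derivative
  of \<open>F\<close> at \<open>B\<close>, which is \<open>linear_part\<close>, times
  \<open>A\<close>.\<close>

lemma linear_part_affine:
  assumes A: "A \<in> carrier_mat k k" and p: "p < k" and x: "x < k"
  shows "Poly_Mapping.lookup (F_poly k m C (affine_poly k A B) p) (exponents [x]) =
    (\<Sum>l<k. linear_part k m C B $$ (p, l) * A $$ (l, x))"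
proof -
  have affine: "Poly_Mapping.lookup (affine_poly k A B q) 0 = B $ q"
    "Poly_Mapping.lookup (affine_poly k A B q) (exponents [x]) = A $$ (q, x)" for q
    using x by (simp_all add: affine_poly_def lookup_add lookup_sum lookup_mult_0
      lookup_mult_linear lookup_const lookup_var if_distrib[of "(*) _"] cong: if_cong)
  have "(\<Sum>l<k. linear_part k m C B $$ (p, l) * A $$ (l, x)) =
      (\<Sum>l<k. \<Sum>s = 1..m. (\<Sum>ls\<in>index_lists k (s - 1). 1 / fact (s - 1) *
        (\<Sum>\<sigma> | \<sigma> permutes {..<s}. C p (permute_list \<sigma> (l # ls)) * (\<Prod>t<s - 1. B $ (ls ! t)))
          * A $$ (l, x)))"
    using p by (simp add: linear_part_def sum_distrib_right)
  also have "\<dots> = (\<Sum>s = 1..m. \<Sum>l<k. (\<Sum>ls\<in>index_lists k (s - 1). 1 / fact (s - 1) *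
        (\<Sum>\<sigma> | \<sigma> permutes {..<s}. C p (permute_list \<sigma> (l # ls)) * (\<Prod>t<s - 1. B $ (ls ! t)))
          * A $$ (l, x)))"
    by (rule sum.swap)
  also have "\<dots> = (\<Sum>s = 1..m. \<Sum>ls\<in>index_lists k s. C p ls *
      (\<Sum>t<s. A $$ (ls ! t, x) * (\<Prod>r\<in>{..<s} - {t}. B $ (ls ! r))))"
  proof (rule sum.cong[OF refl])
    fix s assume "s \<in> {1..m}"
    then have s: "s = Suc (s - 1)"
      by simp
    show "(\<Sum>l<k. (\<Sum>ls\<in>index_lists k (s - 1). 1 / fact (s - 1) *
        (\<Sum>\<sigma> | \<sigma> permutes {..<s}. C p (permute_list \<sigma> (l # ls)) * (\<Prod>t<s - 1. B $ (ls ! t)))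
          * A $$ (l, x))) = (\<Sum>ls\<in>index_lists k s. C p ls *
      (\<Sum>t<s. A $$ (ls ! t, x) * (\<Prod>r\<in>{..<s} - {t}. B $ (ls ! r))))"
      using derivative_symmetrized[where k = k and n = "s - 1" and c = "C p" and b = "\<lambda>i. B $ i"
        and a = "\<lambda>l. A $$ (l, x)"]
      unfolding s[symmetric] .
  qed
  also have "\<dots> = Poly_Mapping.lookup (F_poly k m C (affine_poly k A B) p) (exponents [x])"
    by (simp add: F_poly_def lookup_add lookup_sum lookup_mult_linear lookup_const
      lookup_prod_linear affine)
  finally show ?thesis
    by simp
qed

text \<open>The right-hand side is \<open>F(B)\<close> in symmetrized form, so the equation imposed
  on \<open>B\<close> says that \<open>B\<close> is a fixed point of \<open>F\<close>.\<close>

lemma F_poly_affine_const: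
  "Poly_Mapping.lookup (F_poly k m C (affine_poly k A B) p) 0 =
    (\<Sum>s = 0..m. 1 / fact s * (\<Sum>ls\<in>index_lists k s.
      \<Sum>\<sigma> | \<sigma> permutes {..<s}. C p (permute_list \<sigma> ls) * (\<Prod>t<s. B $ (ls ! t))))"
proof -
  have affine: "Poly_Mapping.lookup (affine_poly k A B q) 0 = B $ q" for q
    by (simp add: affine_poly_def lookup_add lookup_sum lookup_mult_0 lookup_const lookup_var)
  have "(\<Sum>s = 0..m. 1 / fact s * (\<Sum>ls\<in>index_lists k s.
      \<Sum>\<sigma> | \<sigma> permutes {..<s}. C p (permute_list \<sigma> ls) * (\<Prod>t<s. B $ (ls ! t)))) =
    (\<Sum>s = 0..m. \<Sum>ls\<in>index_lists k s. C p ls * (\<Prod>t<s. B $ (ls ! t)))"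
    by (simp only: value_symmetrized[where c = "C p" and b = "\<lambda>i. B $ i"])
  also have "\<dots> = C p [] + (\<Sum>s = 1..m. \<Sum>ls\<in>index_lists k s. C p ls * (\<Prod>t<s. B $ (ls ! t)))"
  proof -
    have "index_lists k 0 = {[]}"
      by (auto simp: index_lists_def)
    then show ?thesis
      by (simp add: sum.atLeast_Suc_atMost[of 0])
  qed
  also have "\<dots> = Poly_Mapping.lookup (F_poly k m C (affine_poly k A B) p) 0"
    by (simp add: F_poly_def lookup_add lookup_sum lookup_mult_0 lookup_const lookup_prod_0 affine)
  finally show ?thesis
    by simp
qed

text \<open>The constant term of \<open>G\<close> is \<open>A' (F(B) - B) = 0\<close>, and its
  linear part is the given upper triangular matrix, so component \<open>l\<close> has no linear term
  in \<open>w_x\<close> with \<open>x < l\<close>.\<close>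

lemma initial_G:
  assumes A: "A \<in> carrier_mat k k" and A': "A' \<in> carrier_mat k k"
    and B_fixed: "\<And>p. p < k \<Longrightarrow>
      B $ p = (\<Sum>s = 0..m. 1 / fact s * (\<Sum>ls\<in>index_lists k s.
        \<Sum>\<sigma> | \<sigma> permutes {..<s}. C p (permute_list \<sigma> ls) * (\<Prod>t<s. B $ (ls ! t))))"
    and triangular: "upper_triangular (A' * linear_part k m C B * A)"
    and l: "l < k"
  shows "initial (G_poly k m C A A' B l) (exponents [l])
    ((A' * linear_part k m C B * A) $$ (l, l))"
proof -
  let ?G = "G_poly k m C A A' B l"
  have L: "linear_part k m C B \<in> carrier_mat k k"
    by (simp add: linear_part_def)
  have "Poly_Mapping.lookup ?G 0 = 0"
    using B_fixed by (simp add: G_poly_def lookup_sum lookup_mult_0 lookup_minus lookup_const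
      F_poly_affine_const)
  moreover have linear: "Poly_Mapping.lookup ?G (exponents [x]) =
      (A' * linear_part k m C B * A) $$ (l, x)" if "x < k" for x
  proof -
    have "Poly_Mapping.lookup ?G (exponents [x]) =
        (\<Sum>q<k. A' $$ (l, q) * (\<Sum>j<k. linear_part k m C B $$ (q, j) * A $$ (j, x)))"
      by (simp add: G_poly_def lookup_sum lookup_mult_linear lookup_minus lookup_const
        linear_part_affine[OF A _ that])
    also have "\<dots> = (A' * (linear_part k m C B * A)) $$ (l, x)"
      using A A' L l that by (simp add: scalar_prod_def atLeast0LessThan)
    also have "A' * (linear_part k m C B * A) = A' * linear_part k m C B * A"
      using A A' L by simp
    finally show ?thesis .
  qed
  moreover have "(A' * linear_part k m C B * A) $$ (l, x) = 0" if "x < l" for x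
    using triangular that l A' by (intro upper_triangularD) auto
  ultimately show ?thesis
    using initial_linear[of ?G l] l by (simp add: linear)
qed

section \<open>Distinctness of the diagonal entries\<close>

lemma exp_ln_Arg:
  assumes "z \<noteq> 0"
  shows "exp (Complex (ln (cmod z)) (Arg z)) = z"
proof -
  have "exp (Complex (ln (cmod z)) (Arg z)) = rcis (cmod z) (Arg z)"
    using assms by (simp add: exp_eq_polar rcis_def)
  then show ?thesis
    by (simp only: rcis_cmod_Arg)
qed

lemma prod_list_count:
  fixes f :: "nat \<Rightarrow> complex"
  assumes "set ls \<subseteq> {..<k}"
  shows "(\<Prod>l\<leftarrow>ls. f l) = (\<Prod>j<k. f j ^ count (mset ls) j)"
  using assms
proof (induction ls)
  case (Cons l ls)
  have "(\<Prod>j<k. f j ^ count (mset (l # ls)) j)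
      = (\<Prod>j<k. (if j = l then f j else 1) * f j ^ count (mset ls) j)"
    by (intro prod.cong) auto
  also have "\<dots> = f l * (\<Prod>j<k. f j ^ count (mset ls) j)"
    using Cons.prems by (simp add: prod.distrib)
  finally show ?case
    using Cons by simp
qed simp

text \<open>Two factorizations of the characteristic polynomial have the same multiset of roots. The
  numbering \<open>lam\<close> need not follow the diagonal, hence the permutation.\<close>

lemma char_poly_upper_triangular_diag:
  fixes M :: "complex mat"
  assumes M: "M \<in> carrier_mat k k" "upper_triangular M"
    and char: "char_poly M = (\<Prod>j<k. [:- lam j, 1:])"
  obtains \<pi> where "\<pi> permutes {..<k}" "\<And>j. j < k \<Longrightarrow> M $$ (j, j) = lam (\<pi> j)"
proof -
  have "char_poly M = (\<Prod>j<k. [:- (M $$ (j, j)), 1:])"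
    using char_poly_upper_triangular[OF M] M(1)
    by (simp add: diag_mat_def prod.list_conv_set_nth comp_def atLeast0LessThan)
  then have eq: "(\<Prod>j<k. [:- (M $$ (j, j)), 1:]) = (\<Prod>j<k. [:- lam j, 1:])"
    using char by simp
  have roots: "proots (\<Prod>j<k. [:- f j, 1:]) = image_mset f (mset_set {..<k})"
    for f :: "nat \<Rightarrow> complex"
  proof -
    have "proots (\<Prod>j<k. [:- f j, 1:]) = (\<Sum>j<k. {#f j#})"
      by (subst proots_prod) simp_all
    also have "\<dots> = image_mset f (mset_set {..<k})"
      by (induction k) (simp_all add: lessThan_Suc)
    finally show ?thesis .
  qed
  have "image_mset (\<lambda>j. M $$ (j, j)) (mset_set {..<k}) = image_mset lam (mset_set {..<k})"
    using arg_cong[OF eq, of proots] unfolding roots .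
  then show thesis
  proof (rule image_mset_eq_implies_permutes[OF finite_lessThan])
    fix \<pi> assume "\<pi> permutes {..<k}" "\<forall>j\<in>{..<k}. M $$ (j, j) = lam (\<pi> j)"
    then show thesis
      by (intro that) simp_all
  qed
qed

text \<open>Equal power products give an integer combination of logarithms whose exponential is 1.
  Its real part vanishes and its imaginary part is a multiple of \<open>2 * pi\<close>, so the
  differences of the exponents solve the system.\<close>

lemma powers_distinct:
  fixes lam :: "nat \<Rightarrow> complex" and ca cb :: "nat \<Rightarrow> nat"
  assumes k: "k \<ge> 1"
    and lam_nonzero: "\<And>j. j < k \<Longrightarrow> lam j \<noteq> 0"
    and lam_0: "cmod (lam 0) \<noteq> 1"
    and no_solution: "\<not> (\<exists>(x :: nat \<Rightarrow> int) (t :: int).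
      ((\<exists>j<k. x j \<noteq> 0) \<or> t \<noteq> 0) \<and>
      of_int (x 0) + (\<Sum>j = 1..<k. of_int (x j) * log (cmod (lam 0)) (cmod (lam j))) = 0 \<and>
      (\<Sum>j<k. Arg (lam j) * of_int (x j)) = 2 * pi * of_int t)"
    and eq: "(\<Prod>j<k. lam j ^ ca j) = (\<Prod>j<k. lam j ^ cb j)"
    and j: "j < k"
  shows "ca j = cb j"
proof (rule ccontr)
  assume neq: "ca j \<noteq> cb j"
  define L where "L i = Complex (ln (cmod (lam i))) (Arg (lam i))" for i
  define x where "x i = int (ca i) - int (cb i)" for i
  have "exp (\<Sum>i<k. of_nat (c i) * L i) = (\<Prod>i<k. lam i ^ c i)" for c
    by (simp add: exp_sum exp_of_nat_mult L_def exp_ln_Arg lam_nonzero)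
  moreover have "(\<Prod>i<k. lam i ^ cb i) \<noteq> 0"
    by (simp add: lam_nonzero)
  ultimately have "exp ((\<Sum>i<k. of_nat (ca i) * L i) - (\<Sum>i<k. of_nat (cb i) * L i)) = 1"
    using eq by (simp add: exp_diff)
  then have exp: "exp (\<Sum>i<k. of_int (x i) * L i) = 1"
    by (simp add: x_def left_diff_distrib sum_subtractf)
  have "exp (Re (\<Sum>i<k. of_int (x i) * L i)) = 1"
    using arg_cong[OF exp, of cmod] by simp
  then have re0: "Re (\<Sum>i<k. of_int (x i) * L i) = 0"
    by simp
  then have re: "(\<Sum>i<k. of_int (x i) * ln (cmod (lam i))) = 0"
    by (simp add: L_def)
  have "cos (Im (\<Sum>i<k. of_int (x i) * L i)) = 1"
    using arg_cong[OF exp, of Re] unfolding Re_exp re0 by simp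
  then obtain t :: int where "Im (\<Sum>i<k. of_int (x i) * L i) = of_int t * 2 * pi"
    unfolding cos_one_2pi_int by blast
  then have im: "(\<Sum>i<k. Arg (lam i) * of_int (x i)) = 2 * pi * of_int t"
    by (simp add: L_def mult_ac)
  \<comment> \<open>Nonzero because \<open>lam 0\<close> lies off the unit circle; dividing by it
    turns natural logarithms into logarithms to the base \<open>cmod (lam 0)\<close>.\<close>
  have ln0: "ln (cmod (lam 0)) \<noteq> 0"
    using lam_0 lam_nonzero[of 0] k by simp
  have "{..<k} = insert 0 {1..<k}"
    using k by auto
  then have "of_int (x 0) * ln (cmod (lam 0)) + (\<Sum>i = 1..<k. of_int (x i) * ln (cmod (lam i))) = 0"
    using re by simp
  then have "(of_int (x 0) * ln (cmod (lam 0))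
      + (\<Sum>i = 1..<k. of_int (x i) * ln (cmod (lam i)))) / ln (cmod (lam 0)) = 0"
    by simp
  then have "of_int (x 0) + (\<Sum>i = 1..<k. of_int (x i) * log (cmod (lam 0)) (cmod (lam i))) = 0"
    using ln0 by (simp add: add_divide_distrib sum_divide_distrib log_def)
  moreover have "x j \<noteq> 0"
    using neq by (simp add: x_def)
  ultimately show False
    using no_solution im j by blast
qed

section \<open>The closed formula for the recurrence\<close>

lemma poly_value_F:
  "poly_value w (F_poly k m C (affine_poly k A B) p) =
    C p [] + (\<Sum>j = 1..m. \<Sum>ls\<in>index_lists k j.
      C p ls * (\<Prod>s<j. (\<Sum>x<k. A $$ (ls ! s, x) * w x) + B $ (ls ! s)))"
  by (simp add: F_poly_def affine_poly_def poly_value_add poly_value_sum poly_value_mult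
    poly_value_prod poly_value_const poly_value_var)

theorem theorem3p4:
  fixes k m :: nat
    and u :: "nat \<Rightarrow> nat \<Rightarrow> complex"
    and C :: "nat \<Rightarrow> nat list \<Rightarrow> complex"
    and A A' :: "complex mat" and B :: "complex vec"
    and lam :: "nat \<Rightarrow> complex"
  assumes k: "k \<ge> 1" and m: "m \<ge> 1"
    and C_sorted: "\<And>j p ls. j \<le> m \<Longrightarrow> p < k \<Longrightarrow> ls \<in> index_lists k j \<Longrightarrow> \<not> sorted ls \<Longrightarrow> C p ls = 0"
    and recurrence: "\<And>i p. i \<ge> 1 \<Longrightarrow> p < k \<Longrightarrow>
      state k u i $ p = C p [] +
        (\<Sum>j = 1..m. \<Sum>ls\<in>index_lists k j. C p ls * (\<Prod>s<j. state k u (i - 1) $ (ls ! s)))"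
    and B: "B \<in> carrier_vec k"
    and B_fixed: "\<And>p. p < k \<Longrightarrow>
      B $ p = (\<Sum>s = 0..m. 1 / fact s * (\<Sum>ls\<in>index_lists k s.
        \<Sum>\<sigma> | \<sigma> permutes {..<s}. C p (permute_list \<sigma> ls) * (\<Prod>t<s. B $ (ls ! t))))"
    and A: "A \<in> carrier_mat k k"
    and A': "A' \<in> carrier_mat k k" "inverts_mat A A'" "inverts_mat A' A"
    and triangular: "upper_triangular (A' * linear_part k m C B * A)"
    and eigenvalues: "char_poly (A' * linear_part k m C B * A) = (\<Prod>j<k. [:- lam j, 1:])"
    and lam_nonzero: "\<And>j. j < k \<Longrightarrow> lam j \<noteq> 0"
    and lam_0: "cmod (lam 0) \<noteq> 1"
    and no_solution: "\<not> (\<exists>(x :: nat \<Rightarrow> int) (t :: int).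
      ((\<exists>j<k. x j \<noteq> 0) \<or> t \<noteq> 0) \<and>
      of_int (x 0) + (\<Sum>j = 1..<k. of_int (x j) * log (cmod (lam 0)) (cmod (lam j))) = 0 \<and>
      (\<Sum>j<k. Arg (lam j) * of_int (x j)) = 2 * pi * of_int t)"
  defines "T \<equiv> transition k m C A A' B"
    and "y \<equiv> auxiliary k (A' *\<^sub>v (state k u 0 - B))"
  shows "\<forall>n\<in>{1..k}. \<forall>i.
    (\<forall>s\<in>{1..k}. summable (\<lambda>l. \<Sum>j = 1..Suc l.
       A $$ (n - 1, s - 1) * evec T s j * T j j ^ i * evec_inv T j (Suc l) * y (Suc l))) \<and>
    u n i = B $ (n - 1) + (\<Sum>s = 1..k. suminf (\<lambda>l. \<Sum>j = 1..Suc l.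
       A $$ (n - 1, s - 1) * evec T s j * T j j ^ i * evec_inv T j (Suc l) * y (Suc l)))"
proof -
  define M where "M = A' * linear_part k m C B * A"
  have M: "M \<in> carrier_mat k k" "upper_triangular M"
    using A A'(1) triangular by (auto simp: M_def linear_part_def)
  have AA': "A * A' = 1\<^sub>m k" "A' * A = 1\<^sub>m k"
    using A A' by (auto simp: inverts_mat_def)
  obtain \<pi> where \<pi>: "\<pi> permutes {..<k}" "\<And>j. j < k \<Longrightarrow> M $$ (j, j) = lam (\<pi> j)"
    using char_poly_upper_triangular_diag[OF M, of lam] eigenvalues unfolding M_def by blast
  have init: "initial (G_poly k m C A A' B l) (exponents [l]) (lam (\<pi> l))" if "l < k" for l
    using initial_G[OF A A'(1) B_fixed triangular that] \<pi>(2)[OF that] by (simp add: M_def)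
  have upper: "T a b = 0" if "a > b" for a b
    unfolding T_def using transition_upper[OF k that init] .
  \<comment> \<open>The exponents are regrouped by eigenvalue through the inverse of
    \<open>\<pi>\<close>, the form that \<open>powers_distinct\<close> expects.\<close>
  have diag: "T a a = (\<Prod>j<k. lam j ^ count (mset (monomial_at k a)) (Hilbert_Choice.inv \<pi> j))" for a
  proof -
    have "T a a = (\<Prod>l\<leftarrow>monomial_at k a. lam (\<pi> l))"
      unfolding T_def using transition_diag[OF k init] .
    also have "\<dots> = (\<Prod>j<k. lam (\<pi> j) ^ count (mset (monomial_at k a)) j)"
      using monomial_at(1)[OF k, of a] by (intro prod_list_count) (auto simp: monomials_def)
    also have "\<dots> = (\<Prod>j<k. lam j ^ count (mset (monomial_at k a)) (Hilbert_Choice.inv \<pi> j))"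
      by (subst prod.reindex_bij_betw[OF permutes_imp_bij[OF \<pi>(1)], symmetric])
        (simp add: permutes_inverses(2)[OF \<pi>(1)])
    finally show ?thesis .
  qed
  have distinct: "T a a \<noteq> T b b" if "a < b" for a b
  proof
    assume "T a a = T b b"
    then have eq: "count (mset (monomial_at k a)) (Hilbert_Choice.inv \<pi> j)
        = count (mset (monomial_at k b)) (Hilbert_Choice.inv \<pi> j)" if "j < k" for j
      using powers_distinct[OF k lam_nonzero lam_0 no_solution _ that,
        of "\<lambda>j. count (mset (monomial_at k a)) (Hilbert_Choice.inv \<pi> j)"
           "\<lambda>j. count (mset (monomial_at k b)) (Hilbert_Choice.inv \<pi> j)"]
      by (simp only: diag)
    have "count (mset (monomial_at k a)) j = count (mset (monomial_at k b)) j" for j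
    proof (cases "j < k")
      case True
      then have "\<pi> j < k"
        using permutes_in_image[OF \<pi>(1), of j] by simp
      from eq[OF this] show ?thesis
        by (simp add: permutes_inverses(2)[OF \<pi>(1)])
    next
      case False
      then have "j \<notin> set (monomial_at k a)" "j \<notin> set (monomial_at k b)"
        using monomial_at(1)[OF k] by (auto simp: monomials_def)
      then show ?thesis
        by (metis count_eq_zero_iff set_mset_mset)
    qed
    then have "exponents (monomial_at k a) = exponents (monomial_at k b)"
      by (simp add: exponents_eq_iff multiset_eq_iff)
    then have "a = b"
      using bij_betw_exponents_monomial_at[OF k] unfolding bij_betw_def by (meson UNIV_I inj_onD)
    then show False
      using that by simp
  qed
  define z where "z i = state k u i" for i
  define w where "w i = A' *\<^sub>v (z i - B)" for i
  have z: "z i \<in> carrier_vec k" for i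
    by (simp add: z_def state_def)
  have w: "w i \<in> carrier_vec k" for i
    using A'(1) by (auto simp: w_def intro: mult_mat_vec_carrier[OF _ minus_carrier_vec[OF z B]])
  \<comment> \<open>Inverting the substitution: \<open>z = A w + B\<close>, so evaluating
    \<open>affine_poly\<close> at \<open>w i\<close> returns the original state.\<close>
  have z_w: "z i $ q = (\<Sum>x<k. A $$ (q, x) * w i $ x) + B $ q" if "q < k" for i q
  proof -
    have "A *\<^sub>v w i = (A * A') *\<^sub>v (z i - B)"
      unfolding w_def using A A'(1) z B by (subst assoc_mult_mat_vec) auto
    then have "A *\<^sub>v w i = z i - B"
      using z B by (simp add: AA')
    then have "(A *\<^sub>v w i) $ q = z i $ q - B $ q"
      using that z B by simp
    moreover have "(A *\<^sub>v w i) $ q = (\<Sum>x<k. A $$ (q, x) * w i $ x)"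
      using that A w[of i] by (simp add: scalar_prod_def atLeast0LessThan)
    ultimately show ?thesis
      by simp
  qed
  have F: "poly_value (\<lambda>x. w i $ x) (F_poly k m C (affine_poly k A B) q) = z (Suc i) $ q"
    if "q < k" for i q
  proof -
    have "(\<Prod>s<j. (\<Sum>x<k. A $$ (ls ! s, x) * w i $ x) + B $ (ls ! s)) = (\<Prod>s<j. z i $ (ls ! s))"
      if "ls \<in> index_lists k j" for j ls
    proof (rule prod.cong[OF refl])
      fix s assume "s \<in> {..<j}"
      then have "ls ! s \<in> set ls" "set ls \<subseteq> {..<k}"
        using that by (auto simp: index_lists_def)
      then have "ls ! s < k"
        by blast
      then show "(\<Sum>x<k. A $$ (ls ! s, x) * w i $ x) + B $ (ls ! s) = z i $ (ls ! s)"
        by (simp add: z_w)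
    qed
    then show ?thesis
      using recurrence[of "Suc i" q] that by (simp add: poly_value_F z_def)
  qed
  have G: "poly_value (\<lambda>x. w i $ x) (G_poly k m C A A' B p) = w (Suc i) $ p" if "p < k" for i p
  proof -
    have "poly_value (\<lambda>x. w i $ x) (G_poly k m C A A' B p)
        = (\<Sum>q<k. A' $$ (p, q) * (z (Suc i) $ q - B $ q))"
      by (simp add: G_poly_def poly_value_sum poly_value_mult poly_value_diff poly_value_const F)
    also have "\<dots> = w (Suc i) $ p"
      using that A'(1) z[of "Suc i"] B by (simp add: w_def scalar_prod_def atLeast0LessThan)
    finally show ?thesis .
  qed
  \<comment> \<open>The auxiliary vector of the transformed recurrence at time \<open>i\<close>;
    \<open>Y 0\<close> is \<open>y\<close>.\<close>
  define Y where "Y i = auxiliary k (w i)" for i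
  have G_prod: "vars_below k (\<Prod>l\<leftarrow>monomial_at k b. G_poly k m C A A' B l)" for b
    by (intro vars_below_prod_list vars_below_G)
  have finite: "finite {c. T b c \<noteq> 0}" for b
    unfolding T_def transition_def by (rule poly_value_rows(1)[OF k G_prod])
  \<comment> \<open>Row \<open>b\<close> holds the coefficients of the substituted monomial
    \<open>b\<close>, and evaluation commutes with substitution.\<close>
  have evolution: "Y (Suc i) b = (\<Sum>c | T b c \<noteq> 0. T b c * Y i c)" for i b
  proof -
    have "(\<Sum>c | T b c \<noteq> 0. T b c * Y i c)
        = poly_value (\<lambda>x. w i $ x) (\<Prod>l\<leftarrow>monomial_at k b. G_poly k m C A A' B l)"
      unfolding T_def transition_def Y_def auxiliary_def
      by (rule poly_value_rows(2)[OF k G_prod, symmetric])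
    also have "\<dots> = (\<Prod>l\<leftarrow>monomial_at k b. w (Suc i) $ l)"
      unfolding poly_value_prod_list using monomial_at(1)[OF k, of b]
      by (intro arg_cong[where f = prod_list] map_cong refl G) (auto simp: monomials_def)
    finally show ?thesis
      by (simp add: Y_def auxiliary_def)
  qed
  \<comment> \<open>Entry \<open>s\<close> of the auxiliary vector is component \<open>s - 1\<close>
    of \<open>w i\<close>, because entry \<open>0\<close> is the constant monomial.\<close>
  have sums: "(\<lambda>l. \<Sum>j = 1..Suc l. A $$ (n - 1, s - 1) * evec T s j * T j j ^ i
      * evec_inv T j (Suc l) * y (Suc l)) sums (A $$ (n - 1, s - 1) * w i $ (s - 1))"
    if s: "s \<in> {1..k}" for n s i
  proof -
    have "monomial_at k s = [s - 1]"
      using s monomial_at_Suc[of "s - 1" k] by (cases s) auto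
    then have "Y i s = w i $ (s - 1)"
      by (simp add: Y_def auxiliary_def)
    moreover have "(\<lambda>a. diag_power T i s a * Y 0 a) sums Y i s"
      by (rule diag_power_sums) (use upper distinct finite evolution in auto)
    ultimately have "(\<lambda>l. \<Sum>j = 1..Suc l. evec T s j * T j j ^ i * evec_inv T j (Suc l) * Y 0 (Suc l))
        sums (w i $ (s - 1))"
      using s sums_without_0[of T i s "Y 0"] by simp
    from sums_mult[OF this, of "A $$ (n - 1, s - 1)"] show ?thesis
      by (simp only: sum_distrib_left mult.assoc y_def Y_def w_def z_def)
  qed
  show ?thesis
  proof (intro ballI allI conjI)
    fix n i assume n: "n \<in> {1..k}"
    show "summable (\<lambda>l. \<Sum>j = 1..Suc l. A $$ (n - 1, s - 1) * evec T s j * T j j ^ i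
        * evec_inv T j (Suc l) * y (Suc l))" if "s \<in> {1..k}" for s
      using sums[OF that] by (rule sums_summable)
    have "u n i = z i $ (n - 1)"
      using n by (cases n) (auto simp: z_def state_def)
    also have "\<dots> = B $ (n - 1) + (\<Sum>x<k. A $$ (n - 1, x) * w i $ x)"
      using n by (subst z_w) auto
    also have "(\<Sum>x<k. A $$ (n - 1, x) * w i $ x)
        = (\<Sum>s = 1..k. A $$ (n - 1, s - 1) * w i $ (s - 1))"
      by (rule sum.reindex_bij_witness[of _ "\<lambda>s. s - 1" Suc]) auto
    also have "\<dots> = (\<Sum>s = 1..k. suminf (\<lambda>l. \<Sum>j = 1..Suc l. A $$ (n - 1, s - 1) * evec T s j
        * T j j ^ i * evec_inv T j (Suc l) * y (Suc l)))"
      by (intro sum.cong refl sums_unique sums)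
    finally show "u n i = B $ (n - 1) + (\<Sum>s = 1..k. suminf (\<lambda>l. \<Sum>j = 1..Suc l.
        A $$ (n - 1, s - 1) * evec T s j * T j j ^ i * evec_inv T j (Suc l) * y (Suc l)))" .
  qed
qed

end
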